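(* Let $d_0\ge 2$ be a fixed integer and let $(\mathcal{D}_n)_{n\ge 1}$ be a sequence of dictionaries with $\mathcal{D}_n\subset(\mathbb{C}^{d_0})^{\otimes n}$ (each $\mathcal{D}_n$ is a finite set spanning $(\mathbb{C}^{d_0})^{\otimes n}$). Assume: (i) (normalization) $\langle s,s\rangle=1$ for all $s\in\mathcal{D}_n$ and all $n$; (ii) (subexponential size) $\log_{d_0}|\mathcal{D}_n| \le o\big(\sqrt{d_0^n}\big)$ as $n\to\infty$; (iii) (closed under complex conjugation) if $s\in\mathcal{D}_n$, then $s^*\in\mathcal{D}_n$; (iv) (closed under tensor products) for all $n_1,n_2\ge 1$, $\mathcal{D}_{n_1}\otimes\mathcal{D}_{n_2}:=\{s_1\otimes s_2 : s_1\in\mathcal{D}_{n_1},\, s_2\in\mathcal{D}_{n_2}\}\subset\mathcal{D}_{n_1+n_2}$; (v) (contains the maximally entangled state) for every $n$, $\Phi=\frac{1}{\sqrt{d_0^n}}\sum_{k\in\mathbb{Z}_{d_0}^n}e_k\otimes e_k\in\mathcal{D}_{2n}$, where $\{e_k\}_{k\in\mathbb{Z}_{d_0}^n}$ is the standard basis of $(\mathbb{C}^{d_0})^{\otimes n}$. Let $\psi\in(\mathbb{C}^{d_0})^{\otimes n}$ be a Haar-random unit vector (i.e. distributed according to the uniform probability measure on the unit sphere). Then, as $n\to\infty$, $$\Pr\big[\,\xi_{\mathcal{D}_{2n}}(\psi\otimes\psi^* )<\xi_{\mathcal{D}_n}(\psi)\,\xi_{\mathcal{D}_n}(\psi^* )\,\big]\ge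 1-o(1).$$ In particular, for all sufficiently large $n$ the extent with respect to the dictionary sequence $(\mathcal{D}_n)$ is strictly submultiplicative, i.e. there exists a unit vector $\psi\in(\mathbb{C}^{d_0})^{\otimes n}$ with $\xi_{\mathcal{D}_{2n}}(\psi\otimes\psi^* )<\xi_{\mathcal{D}_n}(\psi)\,\xi_{\mathcal{D}_n}(\psi^* )$.
   Context: A dictionary in $\mathbb{C}^d$ is a finite set $\mathcal{D}\subset\mathbb{C}^d$ that spans $\mathbb{C}^d$. For $x\in\mathbb{C}^d$, the extent of $x$ with respect to $\mathcal{D}$ is $$\xi_{\mathcal{D}}(x)=\min\Big\{\|c\|_1^2 : c\in\mathbb{C}^{|\mathcal{D}|},\ x=\sum_{s\in\mathcal{D}}c_s s\Big\},\qquad \|c\|_1=\sum_{s\in\mathcal{D}}|c_s|.$$ The inner product on $\mathbb{C}^d$ is $\langle s,y\rangle=\sum_j\overline{s_j}\,y_j$, and $v^*$ denotes the entrywise complex conjugate of $v$ in the standard basis. The space $(\mathbb{C}^{d_0})^{\otimes n}$ is identified with $\mathbb{C}^{d_0^n}$, with standard product basis $e_k=e_{k_1}\otimes\cdots\otimes e_{k_n}$ for $k\in\mathbb{Z}_{d_0}^n$, and $(\mathbb{C}^{d_0})^{\otimes n_1}\otimes(\mathbb{C}^{d_0})^{\otimes n_2}$ is identified with $(\mathbb{C}^{d_0})^{\otimes(n_1+n_2)}$. *)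

theory Defs
  imports "HOL-Probability.Probability" "HOL-Library.NList" "HOL-Library.Landau_Symbols"
begin

text \<open>A vector of the \<open>n\<close>-fold tensor power of \<open>\<complex>\<^sup>d\<close> is the family of its coordinates in the
  standard product basis. A basis index is a list of length \<open>n\<close> with entries below \<open>d\<close>, and a
  coordinate family is a function on these indices that is \<open>undefined\<close> elsewhere. Two vectors are
  thus equal as functions iff their coordinates agree, so that a dictionary is an ordinary set of
  vectors, with the right cardinality.\<close>

definition tensor_space :: "nat \<Rightarrow> nat \<Rightarrow> (nat list \<Rightarrow> complex) set" where
  "tensor_space d n = nlists n {..<d} \<rightarrow>\<^sub>E UNIV"

definition basis_vec :: "nat \<Rightarrow> nat \<Rightarrow> nat list \<Rightarrow> (nat list \<Rightarrow> complex)" where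
  "basis_vec d n k = (\<lambda>j\<in>nlists n {..<d}. if j = k then 1 else 0)"

definition tensor :: "nat \<Rightarrow> nat \<Rightarrow> nat \<Rightarrow> (nat list \<Rightarrow> complex) \<Rightarrow> (nat list \<Rightarrow> complex)
    \<Rightarrow> (nat list \<Rightarrow> complex)" where
  "tensor d m n s t = (\<lambda>k\<in>nlists (m + n) {..<d}. s (take m k) * t (drop m k))"

definition conj_vec :: "nat \<Rightarrow> nat \<Rightarrow> (nat list \<Rightarrow> complex) \<Rightarrow> (nat list \<Rightarrow> complex)" where
  "conj_vec d n s = (\<lambda>k\<in>nlists n {..<d}. cnj (s k))"

definition cinner :: "nat \<Rightarrow> nat \<Rightarrow> (nat list \<Rightarrow> complex) \<Rightarrow> (nat list \<Rightarrow> complex) \<Rightarrow> complex" where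
  "cinner d n s y = (\<Sum>k\<in>nlists n {..<d}. cnj (s k) * y k)"

definition vec_norm :: "nat \<Rightarrow> nat \<Rightarrow> (nat list \<Rightarrow> complex) \<Rightarrow> real" where
  "vec_norm d n x = sqrt (Re (cinner d n x x))"

definition unit_sphere :: "nat \<Rightarrow> nat \<Rightarrow> (nat list \<Rightarrow> complex) set" where
  "unit_sphere d n = {x \<in> tensor_space d n. vec_norm d n x = 1}"

definition max_entangled :: "nat \<Rightarrow> nat \<Rightarrow> (nat list \<Rightarrow> complex)" where
  "max_entangled d n = (\<lambda>j\<in>nlists (2 * n) {..<d}.
     complex_of_real (1 / sqrt (real d ^ n)) *
       (\<Sum>k\<in>nlists n {..<d}. tensor d n n (basis_vec d n k) (basis_vec d n k) j))"

definition represents :: "nat \<Rightarrow> nat \<Rightarrow> (nat list \<Rightarrow> complex) set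
    \<Rightarrow> ((nat list \<Rightarrow> complex) \<Rightarrow> complex) \<Rightarrow> (nat list \<Rightarrow> complex) \<Rightarrow> bool" where
  "represents d n D c x \<longleftrightarrow> (\<forall>k\<in>nlists n {..<d}. x k = (\<Sum>s\<in>D. c s * s k))"

definition dictionary :: "nat \<Rightarrow> nat \<Rightarrow> (nat list \<Rightarrow> complex) set \<Rightarrow> bool" where
  "dictionary d n D \<longleftrightarrow> finite D \<and> D \<subseteq> tensor_space d n \<and>
     (\<forall>x\<in>tensor_space d n. \<exists>c. represents d n D c x)"

text \<open>The infimum below is a minimum, see \<open>extent_is_minimum\<close>.\<close>

definition extent :: "nat \<Rightarrow> nat \<Rightarrow> (nat list \<Rightarrow> complex) set \<Rightarrow> (nat list \<Rightarrow> complex) \<Rightarrow> real" where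
  "extent d n D x = Inf {(\<Sum>s\<in>D. cmod (c s))\<^sup>2 | c. represents d n D c x}"

text \<open>The uniform probability measure on the unit sphere is the normalized cone measure: a set \<open>A\<close>
  of unit vectors has as its probability the Lebesgue volume of \<open>{r x | x \<in> A, 0 < r \<le> 1}\<close>, relative
  to that of the unit ball. The measure lives on the whole space and is concentrated on the sphere;
  the origin, which is not mapped to the sphere, is a null set.\<close>

definition normalize_vec :: "nat \<Rightarrow> nat \<Rightarrow> (nat list \<Rightarrow> complex) \<Rightarrow> (nat list \<Rightarrow> complex)" where
  "normalize_vec d n x = (\<lambda>k\<in>nlists n {..<d}. x k / complex_of_real (vec_norm d n x))"

definition haar_sphere :: "nat \<Rightarrow> nat \<Rightarrow> (nat list \<Rightarrow> complex) measure" where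
  "haar_sphere d n =
     distr (uniform_measure (\<Pi>\<^sub>M k\<in>nlists n {..<d}. lborel) {x \<in> tensor_space d n. vec_norm d n x \<le> 1})
       (\<Pi>\<^sub>M k\<in>nlists n {..<d}. borel) (normalize_vec d n)"

lemma finite_nlists_lessThan [simp]: "finite (nlists n {..<d::nat})"
proof -
  have "nlists n {..<d} = {xs. set xs \<subseteq> {..<d} \<and> length xs = n}"
    unfolding nlists_def by blast
  then show ?thesis
    by (simp add: finite_lists_length_eq)
qed

lemma card_nlists_lessThan: "card (nlists n {..<d::nat}) = d ^ n"
proof -
  have "nlists n {..<d} = {xs. set xs \<subseteq> {..<d} \<and> length xs = n}"
    unfolding nlists_def by blast
  then show ?thesis
    by (simp add: card_lists_length_eq)
qed

lemma vec_norm_eq: "vec_norm d n x = sqrt (\<Sum>k\<in>nlists n {..<d}. (cmod (x k))\<^sup>2)"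
proof -
  have "Re (cnj z * z) = (cmod z)\<^sup>2" for z
    by (simp add: cmod_power2) (simp add: power2_eq_square)
  then show ?thesis
    by (simp add: vec_norm_def cinner_def)
qed

lemma extent_is_minimum:
  assumes D: "dictionary d n D" and x: "x \<in> tensor_space d n"
  obtains c where "represents d n D c x" "extent d n D x = (\<Sum>s\<in>D. cmod (c s))\<^sup>2"
    "\<And>b. represents d n D b x \<Longrightarrow> (\<Sum>s\<in>D. cmod (c s))\<^sup>2 \<le> (\<Sum>s\<in>D. cmod (b s))\<^sup>2"
proof -
  have fin: "finite D" using D by (simp add: dictionary_def)
  obtain a where a: "represents d n D a x" using D x by (auto simp: dictionary_def)
  define R where "R = (\<Sum>s\<in>D. cmod (a s))"
  define B where "B = (\<Pi>\<^sub>E s\<in>UNIV. if s \<in> D then cball 0 R else {0::complex})"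
  define K where "K = B \<inter> {c. represents d n D c x}"
  define cut where "cut c = (\<lambda>s. if s \<in> D then c s else 0 :: complex)"
    for c :: "(nat list \<Rightarrow> complex) \<Rightarrow> complex"
  have "compactin (product_topology (\<lambda>_. euclidean) UNIV) B"
    unfolding B_def compactin_PiE by auto
  then have "compact B"
    unfolding euclidean_product_topology compactin_euclidean_iff .
  moreover have "closed {c. represents d n D c x}"
  proof -
    have "{c. represents d n D c x} =
        (\<Inter>k\<in>nlists n {..<d}. {c. x k = (\<Sum>s\<in>D. c s * s k)})"
      by (auto simp: represents_def)
    moreover have "closed {c. x k = (\<Sum>s\<in>D. c s * s k)}" for k
      by (intro closed_Collect_eq continuous_intros continuous_on_product_coordinates)
    ultimately show ?thesis
      by auto
  qed
  ultimately have "compact K"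
    unfolding K_def by (rule compact_Int_closed)
  have cut_sum: "(\<Sum>s\<in>D. cmod (cut b s)) = (\<Sum>s\<in>D. cmod (b s))" for b
    by (simp add: cut_def)
  have cut_K: "cut b \<in> K" if b: "represents d n D b x" and le: "(\<Sum>s\<in>D. cmod (b s)) \<le> R" for b
  proof -
    have "cmod (b s) \<le> R" if "s \<in> D" for s
      using member_le_sum[of s D "\<lambda>s. cmod (b s)"] that fin le by simp
    then show ?thesis
      using b by (auto simp: K_def B_def cut_def represents_def)
  qed
  have "K \<noteq> {}" using cut_K[OF a] by (auto simp: R_def)
  moreover have "continuous_on K (\<lambda>c. \<Sum>s\<in>D. cmod (c s))"
    by (intro continuous_intros continuous_on_subset[OF continuous_on_product_coordinates]) auto
  ultimately obtain c where c: "c \<in> K"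
    and min: "\<And>b. b \<in> K \<Longrightarrow> (\<Sum>s\<in>D. cmod (c s)) \<le> (\<Sum>s\<in>D. cmod (b s))"
    using continuous_attains_inf[OF \<open>compact K\<close>] by blast
  have le: "(\<Sum>s\<in>D. cmod (c s))\<^sup>2 \<le> (\<Sum>s\<in>D. cmod (b s))\<^sup>2" if b: "represents d n D b x" for b
  proof (rule power_mono)
    show "(\<Sum>s\<in>D. cmod (c s)) \<le> (\<Sum>s\<in>D. cmod (b s))"
    proof (cases "(\<Sum>s\<in>D. cmod (b s)) \<le> R")
      case True
      then show ?thesis using min[OF cut_K[OF b]] cut_sum[of b] by simp
    next
      case False
      then show ?thesis using min[OF cut_K[OF a]] cut_sum[of a] by (simp add: R_def)
    qed
  qed (simp add: sum_nonneg)
  have "extent d n D x = (\<Sum>s\<in>D. cmod (c s))\<^sup>2"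
    unfolding extent_def using c le by (intro cInf_eq_minimum) (auto simp: K_def)
  then show thesis
    using that c le by (auto simp: K_def)
qed

lemma measurable_vec_norm [measurable]:
  "vec_norm d n \<in> borel_measurable (\<Pi>\<^sub>M k\<in>nlists n {..<d}. lborel)"
proof -
  have eq: "vec_norm d n = (\<lambda>x. sqrt (\<Sum>k\<in>nlists n {..<d}. (cmod (x k))\<^sup>2))"
    by (rule ext) (rule vec_norm_eq)
  show ?thesis
    unfolding eq by measurable
qed

lemma measurable_normalize_vec:
  "normalize_vec d n \<in> (\<Pi>\<^sub>M k\<in>nlists n {..<d}. lborel) \<rightarrow>\<^sub>M (\<Pi>\<^sub>M k\<in>nlists n {..<d}. borel)"
  unfolding normalize_vec_def[abs_def]
proof (rule measurable_restrict)
  fix k assume [measurable]: "k \<in> nlists n {..<d}"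
  show "(\<lambda>x. x k / complex_of_real (vec_norm d n x))
      \<in> borel_measurable (\<Pi>\<^sub>M k\<in>nlists n {..<d}. lborel)"
    by measurable
qed

lemma prob_space_haar_sphere:
  assumes d: "0 < d"
  shows "prob_space (haar_sphere d n)"
proof -
  let ?I = "nlists n {..<d}"
  let ?M = "\<Pi>\<^sub>M k\<in>?I. (lborel :: complex measure)"
  let ?B = "{x \<in> tensor_space d n. vec_norm d n x \<le> 1}"
  interpret product_sigma_finite "\<lambda>_::nat list. lborel :: complex measure"
    by standard
  have sp: "space ?M = tensor_space d n"
    by (simp add: space_PiM tensor_space_def)
  have box: "emeasure ?M (?I \<rightarrow>\<^sub>E cball 0 r) = (\<Prod>k\<in>?I. emeasure lborel (cball (0::complex) r))" for r
    by (rule emeasure_PiM) auto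
  have meas: "?B \<in> sets ?M"
    unfolding sp[symmetric] by measurable
  define N where "N = d ^ n"
  have N: "0 < N" using d by (simp add: N_def)
  have cardI: "card ?I = N" by (simp add: N_def card_nlists_lessThan)
  have "(?I \<rightarrow>\<^sub>E cball 0 (1 / sqrt N)) \<subseteq> ?B"
  proof
    fix x :: "nat list \<Rightarrow> complex"
    assume x: "x \<in> ?I \<rightarrow>\<^sub>E cball 0 (1 / sqrt N)"
    have "(cmod (x k))\<^sup>2 \<le> 1 / N" if "k \<in> ?I" for k
    proof -
      have "cmod (x k) \<le> 1 / sqrt N" using x that by (auto simp: PiE_iff)
      then have "(cmod (x k))\<^sup>2 \<le> (1 / sqrt N)\<^sup>2" by (intro power_mono) auto
      then show ?thesis by (simp add: power_divide)
    qed
    then have "(\<Sum>k\<in>?I. (cmod (x k))\<^sup>2) \<le> of_nat (card ?I) * (1 / N)"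
      by (rule sum_bounded_above)
    also have "\<dots> = 1" using N cardI by simp
    finally show "x \<in> ?B" using x by (auto simp: vec_norm_eq tensor_space_def PiE_iff)
  qed
  from emeasure_mono[OF this meas] have "emeasure ?M ?B \<noteq> 0"
    using N less_imp_neq[OF unit_ball_vol_pos[of 2]] by (auto simp: box emeasure_cball)
  moreover have "emeasure ?M ?B \<noteq> \<infinity>"
  proof -
    have "?B \<subseteq> ?I \<rightarrow>\<^sub>E cball 0 1"
    proof
      fix x assume x: "x \<in> ?B"
      have "cmod (x k) \<le> 1" if "k \<in> ?I" for k
      proof -
        have "(cmod (x k))\<^sup>2 \<le> (\<Sum>k\<in>?I. (cmod (x k))\<^sup>2)"
          using that by (intro member_le_sum) auto
        also have "\<dots> \<le> 1" using x by (simp add: vec_norm_eq)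
        finally show ?thesis by (simp add: abs_square_le_1)
      qed
      then show "x \<in> ?I \<rightarrow>\<^sub>E cball 0 1" using x by (auto simp: tensor_space_def PiE_iff)
    qed
    moreover have "(?I \<rightarrow>\<^sub>E cball (0::complex) 1) \<in> sets ?M"
      by (intro sets_PiM_I_finite) auto
    ultimately have "emeasure ?M ?B \<le> emeasure ?M (?I \<rightarrow>\<^sub>E cball 0 1)"
      by (rule emeasure_mono)
    also have "\<dots> < \<infinity>"
      by (simp add: box emeasure_cball ennreal_power)
    finally show ?thesis by simp
  qed
  ultimately have "prob_space (uniform_measure ?M ?B)"
    by (rule prob_space_uniform_measure)
  then show ?thesis
    unfolding haar_sphere_def
    using measurable_normalize_vec[of d n] by (intro prob_space.prob_space_distr) auto
qed

lemma sets_unit_sphere: "unit_sphere d n \<in> sets (haar_sphere d n)"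
proof -
  have "unit_sphere d n = {x \<in> space (\<Pi>\<^sub>M k\<in>nlists n {..<d}. borel).
      sqrt (\<Sum>k\<in>nlists n {..<d}. (cmod (x k))\<^sup>2) = 1}"
    by (simp add: unit_sphere_def tensor_space_def space_PiM vec_norm_eq)
  also have "\<dots> \<in> sets (\<Pi>\<^sub>M k\<in>nlists n {..<d}. borel)"
    by measurable
  finally show ?thesis by (simp add: haar_sphere_def)
qed

lemma AE_haar_sphere_unit:
  assumes d: "0 < d"
  shows "AE x in haar_sphere d n. x \<in> unit_sphere d n"
proof -
  let ?I = "nlists n {..<d}"
  let ?M = "\<Pi>\<^sub>M k\<in>?I. (lborel :: complex measure)"
  interpret product_sigma_finite "\<lambda>_::nat list. lborel :: complex measure"
    by standard
  have "emeasure ?M (?I \<rightarrow>\<^sub>E {0}) = (\<Prod>k\<in>?I. emeasure lborel {0::complex})"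
    by (rule emeasure_PiM) auto
  moreover have "card ?I > 0"
    using d by (simp add: card_nlists_lessThan)
  ultimately have "emeasure ?M (?I \<rightarrow>\<^sub>E {0}) = 0"
    by simp
  moreover have "?I \<rightarrow>\<^sub>E {0::complex} \<in> sets ?M"
    by (intro sets_PiM_I_finite) auto
  ultimately have "?I \<rightarrow>\<^sub>E {0} \<in> null_sets ?M"
    by (rule null_setsI)
  from AE_not_in[OF this] AE_space[of ?M]
  have "AE x in ?M. normalize_vec d n x \<in> unit_sphere d n"
  proof eventually_elim
    case (elim x)
    define r where "r = vec_norm d n x"
    have "\<exists>k\<in>?I. x k \<noteq> 0"
      using elim by (auto simp: space_PiM PiE_iff extensional_def fun_eq_iff split: if_splits)
    then have "(\<Sum>k\<in>?I. (cmod (x k))\<^sup>2) > 0"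
      by (auto intro!: sum_pos2)
    then have r: "(\<Sum>k\<in>?I. (cmod (x k))\<^sup>2) = r\<^sup>2" "r > 0"
      by (auto simp: r_def vec_norm_eq)
    have "vec_norm d n (normalize_vec d n x) = sqrt (\<Sum>k\<in>?I. (cmod (x k))\<^sup>2 / r\<^sup>2)"
      using r(2) unfolding vec_norm_eq[of d n "normalize_vec d n x"]
      by (simp add: normalize_vec_def r_def[symmetric] norm_divide power_divide)
    also have "\<dots> = 1"
      using r by (simp add: sum_divide_distrib[symmetric])
    finally show ?case
      by (simp add: unit_sphere_def tensor_space_def normalize_vec_def)
  qed
  moreover have "{x \<in> tensor_space d n. vec_norm d n x \<le> 1} \<in> sets ?M"
  proof -
    have "{x \<in> tensor_space d n. vec_norm d n x \<le> 1} = {x \<in> space ?M. vec_norm d n x \<le> 1}"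
      by (simp add: space_PiM tensor_space_def)
    then show ?thesis by simp
  qed
  ultimately have "AE x in uniform_measure ?M {x \<in> tensor_space d n. vec_norm d n x \<le> 1}.
      normalize_vec d n x \<in> unit_sphere d n"
    by (intro AE_uniform_measureI) auto
  moreover have "{x \<in> space (\<Pi>\<^sub>M k\<in>?I. borel). x \<in> unit_sphere d n} \<in> sets (\<Pi>\<^sub>M k\<in>?I. borel)"
    using sets_unit_sphere[of d n] sets.sets_into_space[OF sets_unit_sphere[of d n]]
    by (simp add: haar_sphere_def Int_absorb1 flip: Collect_conj_eq Int_def)
  ultimately show ?thesis
    unfolding haar_sphere_def using measurable_normalize_vec[of d n]
    by (subst AE_distr_iff) auto
qed

end

(* Let c be an optimal coefficient vector of psi with respect to D_n, with l1 norm l, so that the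
   extent of psi is l^2, and let N = d^n.

   The cone over a spherical cap, cut off at radius 1, fits into a ball of smaller radius, so a fixed
   unit vector has overlap |<s,psi>|^2 >= 1 / (2 sqrt N) with psi only with probability
   exp(-Omega(sqrt N)). A union bound over the subexponentially large D_n excludes this for all s, and
   then 1 = <psi,psi> forces l^2 >= 2 sqrt N. Almost surely psi also lies in no proper subspace
   spanned by a subset of D_n, so the support of c spans the whole space.

   Expand psi (x) psi^* in the products s (x) t^* with coefficients c_s cnj(c_t), of l1 norm l^2.
   The vector sqrt N * Phi = sum_j e_j (x) e_j is a combination of the same products, with
   coefficients b_st. Trading a small multiple delta of that combination for delta sqrt N * Phi
   changes the l1 norm to first order by delta (sqrt N - |y|^2), where |y|^2 is the derivative in
   the direction b. Optimality of c and Cauchy-Schwarz give |y|^2 >= l^2 > sqrt N, so the trade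
   strictly decreases the norm. *)

theory Submission
  imports Defs
begin

subsection \<open>First-order decrease of the l1 norm\<close>

text \<open>Second-order expansion of the modulus at \<open>c\<close>: its derivative in the
  direction \<open>- b\<close> is \<open>- Re (b * cnj (sgn c))\<close>. The inequality
  \<open>2 * p * q \<le> p^2 + q^2\<close> with \<open>p = cmod c\<close> trades the modulus for its
  square, which expands exactly.\<close>

lemma cmod_perturb_le:
  assumes "c \<noteq> 0"
  shows "cmod (c - of_real \<delta> * b)
    \<le> cmod c - \<delta> * Re (b * cnj (sgn c)) + \<delta>\<^sup>2 * ((cmod b)\<^sup>2 / (2 * cmod c))"
proof -
  have pos: "0 < cmod c" using assms by simp
  have "2 * cmod c * cmod (c - of_real \<delta> * b) \<le> (cmod c)\<^sup>2 + (cmod (c - of_real \<delta> * b))\<^sup>2"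
    using sum_squares_bound[of "cmod c" "cmod (c - of_real \<delta> * b)"] by simp
  also have "(cmod (c - of_real \<delta> * b))\<^sup>2
      = (cmod c)\<^sup>2 - 2 * \<delta> * Re (b * cnj c) + \<delta>\<^sup>2 * (cmod b)\<^sup>2"
    unfolding cmod_power2 by (simp add: power2_eq_square algebra_simps)
  finally have "cmod (c - of_real \<delta> * b)
      \<le> (2 * (cmod c)\<^sup>2 - 2 * \<delta> * Re (b * cnj c) + \<delta>\<^sup>2 * (cmod b)\<^sup>2) / (2 * cmod c)"
    using pos by (simp add: field_simps)
  also have "\<dots> = cmod c - \<delta> * Re (b * cnj c) / cmod c + \<delta>\<^sup>2 * ((cmod b)\<^sup>2 / (2 * cmod c))"
    using pos by (simp add: field_simps power2_eq_square)
  also have "Re (b * cnj c) / cmod c = Re (b * cnj (sgn c))"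
    by (simp add: sgn_eq field_simps add_divide_distrib)
  then have "\<delta> * Re (b * cnj c) / cmod c = \<delta> * Re (b * cnj (sgn c))"
    by (metis times_divide_eq_right)
  finally show ?thesis .
qed

text \<open>The error constant \<open>M\<close> adds up
  \<open>(cmod (b j))^2 / (2 * cmod (c j))\<close> and is independent of \<open>\<delta>\<close>, so
  for small \<open>\<delta>\<close> the linear term decides. At a vanishing coefficient the modulus
  has a kink, hence the assumption on \<open>c\<close>.\<close>

lemma sum_cmod_perturb_le:
  assumes "\<And>j. j \<in> J \<Longrightarrow> c j \<noteq> 0"
  obtains M where "\<And>\<delta>. (\<Sum>j\<in>J. cmod (c j - of_real \<delta> * b j))
    \<le> (\<Sum>j\<in>J. cmod (c j)) - \<delta> * Re (\<Sum>j\<in>J. b j * cnj (sgn (c j))) + \<delta>\<^sup>2 * M"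
proof
  fix \<delta> :: real
  have "(\<Sum>j\<in>J. cmod (c j - of_real \<delta> * b j)) \<le> (\<Sum>j\<in>J. cmod (c j)
      - \<delta> * Re (b j * cnj (sgn (c j))) + \<delta>\<^sup>2 * ((cmod (b j))\<^sup>2 / (2 * cmod (c j))))"
    by (intro sum_mono cmod_perturb_le assms)
  then show "(\<Sum>j\<in>J. cmod (c j - of_real \<delta> * b j))
    \<le> (\<Sum>j\<in>J. cmod (c j)) - \<delta> * Re (\<Sum>j\<in>J. b j * cnj (sgn (c j)))
      + \<delta>\<^sup>2 * (\<Sum>j\<in>J. (cmod (b j))\<^sup>2 / (2 * cmod (c j)))"
    by (simp only: sum.distrib sum_subtractf sum_distrib_left Re_sum)
qed

lemma small_quadratic_pos:
  fixes a M :: real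
  assumes "0 < a"
  obtains \<delta> where "0 < \<delta>" "\<delta>\<^sup>2 * M < \<delta> * a"
proof
  \<comment> \<open>Chosen so that \<open>\<delta> * (\<bar>M\<bar> + 1) = a / 2\<close>; the
    summand 1 keeps the denominator positive when \<open>M = 0\<close>.\<close>
  define \<delta> where "\<delta> = a / (2 * (\<bar>M\<bar> + 1))"
  show pos: "0 < \<delta>" using assms by (simp add: \<delta>_def)
  have "\<delta> * M \<le> \<delta> * (\<bar>M\<bar> + 1)" using pos by (intro mult_left_mono) auto
  also have "\<dots> = a / 2" by (simp add: \<delta>_def field_simps)
  also have "\<dots> < a" using assms by simp
  finally show "\<delta>\<^sup>2 * M < \<delta> * a" using pos by (simp add: power2_eq_square mult.assoc)
qed

subsection \<open>Separating functionals\<close>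

text \<open>Fredholm alternative in coordinates, for the bilinear pairing without conjugation. The
  induction on \<open>S\<close> is Gaussian elimination: a functional that separates the new vector
  from the old ones is the pivot.\<close>

lemma span_or_separating_functional:
  fixes v :: "'b \<Rightarrow> 'a \<Rightarrow> complex" and x :: "'a \<Rightarrow> complex"
  assumes "finite S" and I: "finite I"
  shows "(\<exists>c. \<forall>k\<in>I. x k = (\<Sum>s\<in>S. c s * v s k)) \<or>
    (\<exists>w. (\<forall>s\<in>S. (\<Sum>k\<in>I. w k * v s k) = 0) \<and> (\<Sum>k\<in>I. w k * x k) \<noteq> 0)"
  using assms(1)
proof (induction S arbitrary: x)
  case empty
  show ?case
  proof (cases "\<forall>k\<in>I. x k = 0")
    case False
    have "cnj z * z = of_real ((cmod z)\<^sup>2)" for z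
      using complex_norm_square[of z] by (simp add: mult.commute)
    then have "(\<Sum>k\<in>I. cnj (x k) * x k) = of_real (\<Sum>k\<in>I. (cmod (x k))\<^sup>2)"
      by simp
    moreover have "(\<Sum>k\<in>I. (cmod (x k))\<^sup>2) > 0"
      using False I by (auto intro!: sum_pos2)
    ultimately have "(\<Sum>k\<in>I. cnj (x k) * x k) \<noteq> 0"
      by (metis less_irrefl of_real_eq_0_iff)
    then show ?thesis
      by (intro disjI2 exI[of _ "\<lambda>k. cnj (x k)"]) simp
  qed simp
next
  case (insert u S)
  show ?case
  proof (cases "\<exists>c. \<forall>k\<in>I. v u k = (\<Sum>s\<in>S. c s * v s k)")
    case True
    then obtain c where c: "\<forall>k\<in>I. v u k = (\<Sum>s\<in>S. c s * v s k)" by blast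
    show ?thesis
    proof (cases "\<exists>b. \<forall>k\<in>I. x k = (\<Sum>s\<in>S. b s * v s k)")
      case True
      then obtain b where b: "\<forall>k\<in>I. x k = (\<Sum>s\<in>S. b s * v s k)" by blast
      have "\<forall>k\<in>I. x k = (\<Sum>s\<in>insert u S. (if s = u then 0 else b s) * v s k)"
        using b insert.hyps by (auto intro!: sum.cong)
      then show ?thesis by (intro disjI1 exI)
    next
      case False
      then obtain w where w: "\<forall>s\<in>S. (\<Sum>k\<in>I. w k * v s k) = 0" "(\<Sum>k\<in>I. w k * x k) \<noteq> 0"
        using insert.IH by blast
      have "(\<Sum>k\<in>I. w k * v u k) = (\<Sum>k\<in>I. \<Sum>s\<in>S. c s * (w k * v s k))"
        using c by (auto simp: sum_distrib_left mult_ac intro!: sum.cong)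
      also have "\<dots> = (\<Sum>s\<in>S. c s * (\<Sum>k\<in>I. w k * v s k))"
        by (subst sum.swap) (simp add: sum_distrib_left)
      finally show ?thesis using w by auto
    qed
  next
    case False
    then obtain w0 where w0: "\<forall>s\<in>S. (\<Sum>k\<in>I. w0 k * v s k) = 0" "(\<Sum>k\<in>I. w0 k * v u k) \<noteq> 0"
      using insert.IH by blast
    \<comment> \<open>With this \<open>r\<close> the pivot \<open>w0\<close> vanishes on the
      remainder \<open>x - r * v u\<close>, to which the induction hypothesis is applied.\<close>
    define r where "r = (\<Sum>k\<in>I. w0 k * x k) / (\<Sum>k\<in>I. w0 k * v u k)"
    from insert.IH[of "\<lambda>k. x k - r * v u k"] show ?thesis
    proof (elim disjE exE conjE)
      fix b assume b: "\<forall>k\<in>I. x k - r * v u k = (\<Sum>s\<in>S. b s * v s k)"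
      have "x k = (\<Sum>s\<in>insert u S. (b(u := r)) s * v s k)" if "k \<in> I" for k
      proof -
        have "(\<Sum>s\<in>S. (b(u := r)) s * v s k) = (\<Sum>s\<in>S. b s * v s k)"
          using insert.hyps by (intro sum.cong) auto
        then show ?thesis using b[rule_format, OF that] insert.hyps by (simp add: algebra_simps)
      qed
      then show ?thesis by blast
    next
      fix w assume w: "\<forall>s\<in>S. (\<Sum>k\<in>I. w k * v s k) = 0" "(\<Sum>k\<in>I. w k * (x k - r * v u k)) \<noteq> 0"
      \<comment> \<open>Subtracting \<open>q * w0\<close> makes the functional vanish at
        \<open>u\<close> as well and keeps its zeros on \<open>S\<close>; its value at
        \<open>x\<close> is that of \<open>w\<close> at the remainder.\<close>
      define q where "q = (\<Sum>k\<in>I. w k * v u k) / (\<Sum>k\<in>I. w0 k * v u k)"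
      have dist: "(\<Sum>k\<in>I. (w k - q * w0 k) * y k)
          = (\<Sum>k\<in>I. w k * y k) - q * (\<Sum>k\<in>I. w0 k * y k)" for y
        by (simp add: sum_subtractf sum_distrib_left algebra_simps)
      have "(\<Sum>k\<in>I. w k * (x k - r * v u k))
          = (\<Sum>k\<in>I. w k * x k) - r * (\<Sum>k\<in>I. w k * v u k)"
        by (simp add: sum_subtractf sum_distrib_left algebra_simps)
      then have "(\<Sum>k\<in>I. (w k - q * w0 k) * x k) \<noteq> 0"
        using w(2) unfolding dist by (simp add: q_def r_def mult.commute)
      moreover have "\<forall>s\<in>insert u S. (\<Sum>k\<in>I. (w k - q * w0 k) * v s k) = 0"
        unfolding dist using w w0 by (auto simp: q_def)
      ultimately show ?thesis
        by (intro disjI2 exI[of _ "\<lambda>k. w k - q * w0 k"]) simp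
    qed
  qed
qed

subsection \<open>Lebesgue measure on finite powers\<close>

text \<open>Product measures are determined by boxes. On a box the affine map acts factor by factor,
  and each factor contributes \<open>\<bar>c\<bar> ^ DIM('a)\<close>.\<close>

lemma PiM_lborel_affine:
  fixes a :: "'i \<Rightarrow> 'a::euclidean_space"
  assumes I: "finite I" and c: "c \<noteq> 0"
  shows "(\<Pi>\<^sub>M k\<in>I. lborel) = density (distr (\<Pi>\<^sub>M k\<in>I. lborel) (\<Pi>\<^sub>M k\<in>I. lborel)
    (\<lambda>x. \<lambda>k\<in>I. a k + c *\<^sub>R x k)) (\<lambda>_. ennreal (\<bar>c\<bar> ^ (DIM('a) * card I)))"
    (is "?M = density (distr ?M ?M ?T) _")
proof -
  interpret product_sigma_finite "\<lambda>_::'i. lborel :: 'a measure" by standard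
  have T: "?T \<in> ?M \<rightarrow>\<^sub>M ?M"
    by (intro measurable_restrict) measurable
  show ?thesis
  proof (rule PiM_eqI[symmetric])
    fix A :: "'i \<Rightarrow> 'a set" assume A: "\<And>i. i \<in> I \<Longrightarrow> A i \<in> sets lborel"
    have box: "Pi\<^sub>E I A \<in> sets ?M" using I A by (intro sets_PiM_I_finite) auto
    have pre: "?T -` Pi\<^sub>E I A \<inter> space ?M = (\<Pi>\<^sub>E k\<in>I. (\<lambda>z. a k + c *\<^sub>R z) -` A k)"
      by (auto simp: space_PiM PiE_iff)
    have Apre: "(\<lambda>z. a k + c *\<^sub>R z) -` A k \<in> sets lborel" if "k \<in> I" for k
    proof -
      have "(\<lambda>z. a k + c *\<^sub>R z) -` A k \<inter> space lborel \<in> sets lborel"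
        using A[OF that] by (intro measurable_sets[where A=lborel and M=lborel]) auto
      then show ?thesis by simp
    qed
    have one: "ennreal (\<bar>c\<bar> ^ DIM('a)) * emeasure lborel ((\<lambda>z. a k + c *\<^sub>R z) -` A k)
        = emeasure lborel (A k)" if "k \<in> I" for k
    proof -
      have "emeasure lborel (A k) = emeasure (density (distr lborel borel (\<lambda>x. a k + c *\<^sub>R x))
          (\<lambda>_. ennreal (\<bar>c\<bar> ^ DIM('a)))) (A k)"
        using lborel_affine[OF c, of "a k"] by simp
      then show ?thesis
        using A[OF that] by (simp add: emeasure_density_const emeasure_distr)
    qed
    have "emeasure (density (distr ?M ?M ?T) (\<lambda>_. ennreal (\<bar>c\<bar> ^ (DIM('a) * card I)))) (Pi\<^sub>E I A)
        = ennreal (\<bar>c\<bar> ^ (DIM('a) * card I)) * (\<Prod>k\<in>I. emeasure lborel ((\<lambda>z. a k + c *\<^sub>R z) -` A k))"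
      using box T I Apre
      by (simp add: emeasure_density_const emeasure_distr pre emeasure_PiM)
    also have "\<dots> = (\<Prod>k\<in>I. ennreal (\<bar>c\<bar> ^ DIM('a))
        * emeasure lborel ((\<lambda>z. a k + c *\<^sub>R z) -` A k))"
      by (simp add: power_mult ennreal_power prod.distrib)
    also have "\<dots> = (\<Prod>k\<in>I. emeasure lborel (A k))"
      using one by (intro prod.cong) auto
    finally show "emeasure (density (distr ?M ?M ?T)
        (\<lambda>_. ennreal (\<bar>c\<bar> ^ (DIM('a) * card I)))) (Pi\<^sub>E I A) = (\<Prod>k\<in>I. emeasure lborel (A k))" .
  qed (use I in auto)
qed

text \<open>The map \<open>a + r x\<close> carries the unit ball onto the ball around
  \<open>a\<close>. The exponent \<open>2 * card I\<close> is the real dimension.\<close>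

lemma emeasure_PiM_lborel_ball:
  fixes a :: "'i \<Rightarrow> complex"
  assumes I: "finite I" and r: "0 < r"
  shows "emeasure (\<Pi>\<^sub>M k\<in>I. lborel) {x \<in> I \<rightarrow>\<^sub>E UNIV. (\<Sum>k\<in>I. (cmod (x k - a k))\<^sup>2) \<le> r\<^sup>2}
    = ennreal (r ^ (2 * card I)) * emeasure (\<Pi>\<^sub>M k\<in>I. lborel) {x \<in> I \<rightarrow>\<^sub>E UNIV. (\<Sum>k\<in>I. (cmod (x k))\<^sup>2) \<le> 1}"
proof -
  let ?M = "\<Pi>\<^sub>M k\<in>I. (lborel :: complex measure)"
  let ?T = "\<lambda>x. \<lambda>k\<in>I. a k + r *\<^sub>R x k"
  let ?A = "{x \<in> I \<rightarrow>\<^sub>E UNIV. (\<Sum>k\<in>I. (cmod (x k - a k))\<^sup>2) \<le> r\<^sup>2}"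
  have sp: "space ?M = I \<rightarrow>\<^sub>E UNIV" by (simp add: space_PiM)
  have A: "?A \<in> sets ?M" unfolding sp[symmetric] by measurable
  have T: "?T \<in> ?M \<rightarrow>\<^sub>M ?M"
    by (intro measurable_restrict) measurable
  have "(\<Sum>k\<in>I. (cmod (r *\<^sub>R x k))\<^sup>2) = r\<^sup>2 * (\<Sum>k\<in>I. (cmod (x k))\<^sup>2)" for x :: "'i \<Rightarrow> complex"
    by (simp add: power_mult_distrib sum_distrib_left)
  then have pre: "?T -` ?A \<inter> space ?M = {x \<in> I \<rightarrow>\<^sub>E UNIV. (\<Sum>k\<in>I. (cmod (x k))\<^sup>2) \<le> 1}"
    using r by (auto simp: sp)
  have "emeasure ?M ?A = emeasure (density (distr ?M ?M ?T) (\<lambda>_. ennreal (r ^ (2 * card I)))) ?A"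
    using PiM_lborel_affine[OF I, of r a] r by simp
  also have "\<dots> = ennreal (r ^ (2 * card I)) * emeasure ?M (?T -` ?A \<inter> space ?M)"
    using A T by (simp add: emeasure_density_const emeasure_distr)
  finally show ?thesis unfolding pre .
qed

text \<open>Fubini in the coordinate \<open>j\<close>: once the others are fixed, the equation
  allows a single value of \<open>x j\<close>, because \<open>w j \<noteq> 0\<close>.\<close>

lemma null_sets_hyperplane:
  fixes w :: "'i \<Rightarrow> complex"
  assumes I: "finite I" and j: "j \<in> I" "w j \<noteq> 0"
  shows "{x \<in> I \<rightarrow>\<^sub>E UNIV. (\<Sum>k\<in>I. w k * x k) = 0} \<in> null_sets (\<Pi>\<^sub>M k\<in>I. lborel)"
proof -
  interpret product_sigma_finite "\<lambda>_::'i. lborel :: complex measure" by standard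
  define J where "J = I - {j}"
  have J: "finite J" "j \<notin> J" "I = insert j J" using I j by (auto simp: J_def)
  let ?M = "\<Pi>\<^sub>M k\<in>I. (lborel :: complex measure)"
  let ?H = "{x \<in> I \<rightarrow>\<^sub>E UNIV. (\<Sum>k\<in>I. w k * x k) = 0}"
  have sp: "space ?M = I \<rightarrow>\<^sub>E UNIV" by (simp add: space_PiM)
  have H: "?H \<in> sets ?M" unfolding sp[symmetric] by measurable
  have "emeasure ?M ?H = (\<integral>\<^sup>+ x. indicator ?H x \<partial>?M)" using H by simp
  also have "\<dots> = (\<integral>\<^sup>+ x. (\<integral>\<^sup>+ y. indicator ?H (x(j := y)) \<partial>lborel) \<partial>(\<Pi>\<^sub>M k\<in>J. lborel))"
    using H unfolding J(3) by (intro product_nn_integral_insert J) auto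
  also have "\<dots> = (\<integral>\<^sup>+ x. 0 \<partial>(\<Pi>\<^sub>M k\<in>J. (lborel :: complex measure)))"
  proof (rule nn_integral_cong)
    fix x :: "'i \<Rightarrow> complex"
    have eq: "(\<Sum>k\<in>J. w k * (if k = j then y else x k)) = (\<Sum>k\<in>J. w k * x k)" for y
      using J by (intro sum.cong) auto
    have "(\<integral>\<^sup>+ y. indicator ?H (x(j := y)) \<partial>lborel)
        \<le> (\<integral>\<^sup>+ y. indicator {- (\<Sum>k\<in>J. w k * x k) / w j} y \<partial>(lborel :: complex measure))"
      using j J(2) by (intro nn_integral_mono)
        (auto simp: indicator_def J(3) J(1) eq field_simps add_eq_0_iff)
    then show "(\<integral>\<^sup>+ y. indicator ?H (x(j := y)) \<partial>lborel) = 0" by simp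
  qed
  finally show ?thesis using H by (intro null_setsI) auto
qed

subsection \<open>Strict submultiplicativity at a fixed vector\<close>

lemma extent_le:
  assumes "represents d n D c x"
  shows "extent d n D x \<le> (\<Sum>s\<in>D. cmod (c s))\<^sup>2"
  unfolding extent_def using assms by (intro cInf_lower bdd_belowI[of _ 0]) auto

text \<open>The family \<open>g\<close> may name an element of \<open>D\<close> several times, as
  distinct pairs can have equal tensor products. Adding up the coefficients over each fibre of
  \<open>g\<close> does not increase the l1 norm, by the triangle inequality.\<close>

lemma extent_le_family:
  assumes J: "finite J" and D: "finite D" and g: "g ` J \<subseteq> D"
    and x: "\<And>k. k \<in> nlists n {..<d} \<Longrightarrow> x k = (\<Sum>j\<in>J. \<beta> j * g j k)"
  shows "extent d n D x \<le> (\<Sum>j\<in>J. cmod (\<beta> j))\<^sup>2"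
proof -
  define c where "c u = (\<Sum>j | j \<in> J \<and> g j = u. \<beta> j)" for u
  have "represents d n D c x"
    unfolding represents_def
  proof
    fix k assume k: "k \<in> nlists n {..<d}"
    have "(\<Sum>u\<in>D. c u * u k) = (\<Sum>u\<in>D. \<Sum>j | j \<in> J \<and> g j = u. \<beta> j * g j k)"
      unfolding c_def sum_distrib_right by (intro sum.cong) auto
    also have "\<dots> = (\<Sum>j\<in>J. \<beta> j * g j k)"
      by (rule sum.group[OF J D g])
    finally show "x k = (\<Sum>u\<in>D. c u * u k)" using x[OF k] by simp
  qed
  then have "extent d n D x \<le> (\<Sum>u\<in>D. cmod (c u))\<^sup>2" by (rule extent_le)
  also have "\<dots> \<le> (\<Sum>j\<in>J. cmod (\<beta> j))\<^sup>2"
  proof (rule power_mono)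
    have "(\<Sum>u\<in>D. cmod (c u)) \<le> (\<Sum>u\<in>D. \<Sum>j | j \<in> J \<and> g j = u. cmod (\<beta> j))"
      unfolding c_def by (intro sum_mono norm_sum)
    also have "\<dots> = (\<Sum>j\<in>J. cmod (\<beta> j))"
      by (rule sum.group[OF J D g])
    finally show "(\<Sum>u\<in>D. cmod (c u)) \<le> (\<Sum>j\<in>J. cmod (\<beta> j))" .
  qed (simp add: sum_nonneg)
  finally show ?thesis .
qed

text \<open>Conjugating an optimal decomposition of the conjugate vector gives a decomposition of
  \<open>x\<close> with the same l1 norm. This bounds the product of the two extents below by a
  square.\<close>

lemma extent_le_extent_conj:
  assumes D: "dictionary d n D" and conj: "\<And>s. s \<in> D \<Longrightarrow> conj_vec d n s \<in> D"
  shows "extent d n D x \<le> extent d n D (conj_vec d n x)"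
proof -
  have "conj_vec d n x \<in> tensor_space d n"
    by (simp add: conj_vec_def tensor_space_def)
  from extent_is_minimum[OF D this] obtain c where c: "represents d n D c (conj_vec d n x)"
    "extent d n D (conj_vec d n x) = (\<Sum>s\<in>D. cmod (c s))\<^sup>2" .
  have "extent d n D x \<le> (\<Sum>s\<in>D. cmod (cnj (c s)))\<^sup>2"
  proof (rule extent_le_family)
    fix k assume k: "k \<in> nlists n {..<d}"
    have "cnj (x k) = (\<Sum>s\<in>D. c s * s k)"
      using c(1) k by (simp add: represents_def conj_vec_def)
    then have "x k = cnj (\<Sum>s\<in>D. c s * s k)"
      by (metis complex_cnj_cnj)
    then show "x k = (\<Sum>s\<in>D. cnj (c s) * conj_vec d n s k)"
      using k by (simp add: conj_vec_def)
  qed (use D conj in \<open>auto simp: dictionary_def\<close>)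
  then show ?thesis using c(2) by simp
qed

text \<open>Weak duality: expanding one argument of \<open>cinner d n x x = 1\<close> in the
  dictionary leaves coefficients times overlaps with \<open>x\<close>.\<close>

lemma one_le_coefficients_times_overlap:
  assumes x: "x \<in> unit_sphere d n" and c: "represents d n D c x"
    and m: "\<And>s. s \<in> D \<Longrightarrow> cmod (cinner d n s x) \<le> m"
  shows "1 \<le> (\<Sum>s\<in>D. cmod (c s)) * m"
proof -
  have "1 = Re (cinner d n x x)"
    using x by (simp add: unit_sphere_def vec_norm_def)
  also have "cinner d n x x = (\<Sum>k\<in>nlists n {..<d}. \<Sum>s\<in>D. c s * (cnj (x k) * s k))"
    unfolding cinner_def
  proof (rule sum.cong[OF refl])
    fix k assume "k \<in> nlists n {..<d}"
    then have "cnj (x k) * x k = cnj (x k) * (\<Sum>s\<in>D. c s * s k)"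
      using c by (simp add: represents_def)
    then show "cnj (x k) * x k = (\<Sum>s\<in>D. c s * (cnj (x k) * s k))"
      by (simp add: sum_distrib_left mult_ac)
  qed
  also have "\<dots> = (\<Sum>s\<in>D. c s * cnj (cinner d n s x))"
    by (subst sum.swap) (simp add: cinner_def sum_distrib_left mult_ac)
  also have "Re \<dots> \<le> cmod \<dots>" by (rule complex_Re_le_cmod)
  also have "\<dots> \<le> (\<Sum>s\<in>D. cmod (c s * cnj (cinner d n s x)))" by (rule norm_sum)
  also have "\<dots> \<le> (\<Sum>s\<in>D. cmod (c s) * m)"
    using m by (intro sum_mono) (simp add: norm_mult mult_left_mono)
  finally show ?thesis by (simp add: sum_distrib_right)
qed

lemma tensor_apply:
  assumes "k \<in> nlists (2 * n) {..<d}"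
  shows "tensor d n n s t k = s (take n k) * t (drop n k)"
  using assms by (simp add: tensor_def mult_2)

lemma take_drop_nlists:
  assumes "k \<in> nlists (2 * n) A"
  shows "take n k \<in> nlists n A" "drop n k \<in> nlists n A"
proof -
  have "length k = 2 * n" "set k \<subseteq> A" using assms by (simp_all only: nlists_def mem_Collect_eq)
  then show "take n k \<in> nlists n A" "drop n k \<in> nlists n A"
    using order.trans[OF set_take_subset, of k A n] order.trans[OF set_drop_subset, of k A n]
    unfolding nlists_def mem_Collect_eq by (simp_all only: length_take length_drop) simp_all
qed

lemma max_entangled_apply:
  assumes "k \<in> nlists (2 * n) {..<d}"
  shows "max_entangled d n k
    = complex_of_real (1 / sqrt (real d ^ n)) * (if take n k = drop n k then 1 else 0)"
proof -
  have "(\<Sum>l\<in>nlists n {..<d}. tensor d n n (basis_vec d n l) (basis_vec d n l) k)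
      = (\<Sum>l\<in>nlists n {..<d}. if l = take n k then (if take n k = drop n k then 1 else 0) else 0)"
    using take_drop_nlists[OF assms]
    by (intro sum.cong) (auto simp: tensor_apply[OF assms] basis_vec_def)
  then show ?thesis
    using assms take_drop_nlists[OF assms] by (simp add: max_entangled_def)
qed

text \<open>The phases of an optimal \<open>c\<close> act as a dual certificate. If the inequality
  failed, moving from \<open>c\<close> towards \<open>a\<close> would still represent
  \<open>x\<close> and would lower the l1 norm to first order. The movement stays on the support
  \<open>S\<close>, where every modulus is differentiable.\<close>

lemma optimal_coefficients_dual:
  assumes D: "finite D" and S: "S = {s \<in> D. c s \<noteq> 0}"
    and c: "represents d n D c x"
    and min: "\<And>b. represents d n D b x \<Longrightarrow> (\<Sum>s\<in>D. cmod (c s))\<^sup>2 \<le> (\<Sum>s\<in>D. cmod (b s))\<^sup>2"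
    and a: "represents d n S a x"
  shows "(\<Sum>s\<in>D. cmod (c s)) \<le> Re (\<Sum>s\<in>S. a s * cnj (sgn (c s)))"
proof (rule ccontr)
  define l where "l = (\<Sum>s\<in>D. cmod (c s))"
  have onS: "(\<Sum>s\<in>D. f s) = (\<Sum>s\<in>S. f s)" if "\<And>s. s \<in> D \<Longrightarrow> c s = 0 \<Longrightarrow> f s = 0"
    for f :: "(nat list \<Rightarrow> complex) \<Rightarrow> 'c::comm_monoid_add"
    using that D by (intro sum.mono_neutral_right) (auto simp: S)
  have lS: "l = (\<Sum>s\<in>S. cmod (c s))" unfolding l_def by (rule onS) simp
  obtain M where M: "\<And>\<delta>. (\<Sum>s\<in>S. cmod (c s - of_real \<delta> * (c s - a s)))
    \<le> (\<Sum>s\<in>S. cmod (c s)) - \<delta> * Re (\<Sum>s\<in>S. (c s - a s) * cnj (sgn (c s))) + \<delta>\<^sup>2 * M"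
    using sum_cmod_perturb_le[of S c "\<lambda>s. c s - a s"] S by blast
  have "c s * cnj (sgn (c s)) = of_real (cmod (c s))" for s
    using complex_norm_square[of "c s"]
    by (cases "c s = 0") (simp_all add: sgn_eq power2_eq_square field_simps)
  then have "Re (\<Sum>s\<in>S. (c s - a s) * cnj (sgn (c s))) = l - Re (\<Sum>s\<in>S. a s * cnj (sgn (c s)))"
    by (simp add: left_diff_distrib sum_subtractf lS)
  moreover assume "\<not> (\<Sum>s\<in>D. cmod (c s)) \<le> Re (\<Sum>s\<in>S. a s * cnj (sgn (c s)))"
  ultimately have "0 < Re (\<Sum>s\<in>S. (c s - a s) * cnj (sgn (c s)))" by (simp add: l_def)
  then obtain \<delta> where d: "0 < \<delta>" "\<delta>\<^sup>2 * M < \<delta> * Re (\<Sum>s\<in>S. (c s - a s) * cnj (sgn (c s)))"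
    by (rule small_quadratic_pos)
  \<comment> \<open>An affine combination of two representations of \<open>x\<close>, extended by
    zero to \<open>D\<close>, where \<open>min\<close> speaks.\<close>
  define b where "b s = (if s \<in> S then c s - of_real \<delta> * (c s - a s) else 0)" for s
  have b0: "b s = 0" if "s \<in> D" "c s = 0" for s using that by (simp add: b_def S)
  have "represents d n D b x"
    unfolding represents_def
  proof
    fix k assume k: "k \<in> nlists n {..<d}"
    have "x k = (\<Sum>s\<in>D. c s * s k)" using c k by (simp add: represents_def)
    also have "\<dots> = (\<Sum>s\<in>S. c s * s k)" by (rule onS) simp
    finally have cx: "(\<Sum>s\<in>S. c s * s k) = x k" ..
    have ax: "(\<Sum>s\<in>S. a s * s k) = x k" using a k by (simp add: represents_def)
    have "(\<Sum>s\<in>D. b s * s k) = (\<Sum>s\<in>S. b s * s k)" by (rule onS) (simp add: b0)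
    also have "\<dots> = (\<Sum>s\<in>S. c s * s k - of_real \<delta> * (c s * s k - a s * s k))"
      by (intro sum.cong) (auto simp: b_def algebra_simps)
    also have "\<dots> = x k"
      by (simp add: sum_subtractf sum_distrib_left[symmetric] cx ax)
    finally show "x k = (\<Sum>s\<in>D. b s * s k)" ..
  qed
  from min[OF this] have "l \<le> (\<Sum>s\<in>D. cmod (b s))"
    unfolding l_def by (rule power2_le_imp_le) (simp add: sum_nonneg)
  also have "\<dots> = (\<Sum>s\<in>S. cmod (b s))" by (rule onS) (simp add: b0)
  also have "\<dots> = (\<Sum>s\<in>S. cmod (c s - of_real \<delta> * (c s - a s)))"
    by (intro sum.cong) (auto simp: b_def)
  also have "\<dots> < l" using M[of \<delta>] d by (simp add: lS)
  finally show False by simp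
qed

text \<open>The randomness of \<open>x\<close> enters through \<open>span\<close> and
  \<open>small\<close>. \<open>span\<close> ranges over all subsets of \<open>D\<close>, since it is
  applied to the support of an optimal \<open>c\<close>: the perturbation may use only products of
  elements from that support.\<close>

lemma extent_tensor_conj_less:
  assumes d: "0 < d" and D: "dictionary d n D" and E: "finite E"
    and tens: "\<And>s t. s \<in> D \<Longrightarrow> t \<in> D \<Longrightarrow> tensor d n n s (conj_vec d n t) \<in> E"
    and ent: "max_entangled d n \<in> E"
    and x: "x \<in> unit_sphere d n"
    and span: "\<And>S c j. S \<subseteq> D \<Longrightarrow> represents d n S c x \<Longrightarrow> j \<in> nlists n {..<d}
      \<Longrightarrow> \<exists>a. represents d n S a (basis_vec d n j)"
    and small: "\<And>s. s \<in> D \<Longrightarrow> (cmod (cinner d n s x))\<^sup>2 \<le> 1 / (2 * sqrt (real d ^ n))"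
  shows "extent d (2 * n) E (tensor d n n x (conj_vec d n x)) < (extent d n D x)\<^sup>2"
proof -
  let ?I = "nlists n {..<d}"
  define R where "R = sqrt (real d ^ n)"
  have R: "0 < R" using d by (simp add: R_def)
  have finD: "finite D" using D by (simp add: dictionary_def)
  have xt: "x \<in> tensor_space d n" using x by (simp add: unit_sphere_def)
  obtain c where c: "represents d n D c x" and ext: "extent d n D x = (\<Sum>s\<in>D. cmod (c s))\<^sup>2"
    and min: "\<And>b. represents d n D b x \<Longrightarrow> (\<Sum>s\<in>D. cmod (c s))\<^sup>2 \<le> (\<Sum>s\<in>D. cmod (b s))\<^sup>2"
    using extent_is_minimum[OF D xt] by blast
  define S where "S = {s \<in> D. c s \<noteq> 0}"
  define l where "l = (\<Sum>s\<in>D. cmod (c s))"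
  have SD: "S \<subseteq> D" "finite S" using finD by (auto simp: S_def)
  have lS: "l = (\<Sum>s\<in>S. cmod (c s))"
    unfolding l_def S_def using finD by (intro sum.mono_neutral_right) auto
  have cS: "represents d n S c x"
    unfolding represents_def
  proof
    fix k assume k: "k \<in> ?I"
    have "(\<Sum>s\<in>D. c s * s k) = (\<Sum>s\<in>S. c s * s k)"
      unfolding S_def using finD by (intro sum.mono_neutral_right) auto
    then show "x k = (\<Sum>s\<in>S. c s * s k)" using c k by (simp add: represents_def)
  qed
  have "\<forall>j\<in>?I. \<exists>a. represents d n S a (basis_vec d n j)"
    using span[OF SD(1) cS] by blast
  then obtain a where a: "\<And>j. j \<in> ?I \<Longrightarrow> represents d n S (a j) (basis_vec d n j)"
    by metis
  have a_apply: "(\<Sum>s\<in>S. a j s * s k) = (if k = j then 1 else 0)" if "j \<in> ?I" "k \<in> ?I" for j k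
    using a[OF that(1)] that(2) by (simp add: represents_def basis_vec_def)

  \<comment> \<open>The factor 2 in \<open>small\<close> gives \<open>2 * R \<le> l^2\<close>, and
    so the strict inequality \<open>R < l^2\<close>.\<close>
  have "1 \<le> l * sqrt (1 / (2 * R))"
    unfolding l_def
    by (intro one_le_coefficients_times_overlap[OF x c] real_le_rsqrt) (use small in \<open>simp add: R_def\<close>)
  then have "1\<^sup>2 \<le> (l * sqrt (1 / (2 * R)))\<^sup>2" by (intro power_mono) auto
  then have "2 * R \<le> l\<^sup>2" using R by (simp add: power_mult_distrib field_simps)
  then have lR: "R < l\<^sup>2" using R by simp

  \<comment> \<open>\<open>y j\<close> is the phase functional of \<open>c\<close> on the expansion
    of the basis vector \<open>j\<close>. \<open>b\<close> holds the coefficients of the sum of all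
    \<open>e_j \<otimes> e_j\<close>, and \<open>A\<close> represents \<open>x\<close> by
    substituting these expansions into its coordinates.\<close>
  define y where "y j = (\<Sum>s\<in>S. a j s * cnj (sgn (c s)))" for j
  define b where "b s t = (\<Sum>j\<in>?I. a j s * cnj (a j t))" for s t
  define A where "A s = (\<Sum>j\<in>?I. x j * a j s)" for s
  have "represents d n S A x"
    unfolding represents_def
  proof
    fix k assume k: "k \<in> ?I"
    have "(\<Sum>s\<in>S. A s * s k) = (\<Sum>j\<in>?I. x j * (\<Sum>s\<in>S. a j s * s k))"
      unfolding A_def sum_distrib_right sum_distrib_left by (subst sum.swap) (simp add: mult_ac)
    also have "\<dots> = (\<Sum>j\<in>?I. if j = k then x j else 0)"
      using k by (intro sum.cong) (auto simp: a_apply)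
    also have "\<dots> = x k" using k by simp
    finally show "x k = (\<Sum>s\<in>S. A s * s k)" ..
  qed
  from optimal_coefficients_dual[OF finD S_def c min this]
  have "l \<le> Re (\<Sum>s\<in>S. A s * cnj (sgn (c s)))" by (simp add: l_def)
  also have "(\<Sum>s\<in>S. A s * cnj (sgn (c s))) = (\<Sum>j\<in>?I. x j * y j)"
    unfolding A_def y_def sum_distrib_right sum_distrib_left by (subst sum.swap) (simp add: mult_ac)
  also have "Re \<dots> \<le> cmod \<dots>" by (rule complex_Re_le_cmod)
  also have "\<dots> \<le> (\<Sum>j\<in>?I. cmod (x j) * cmod (y j))"
    using norm_sum[of "\<lambda>j. x j * y j" ?I] by (simp add: norm_mult)
  finally have "l \<le> (\<Sum>j\<in>?I. cmod (x j) * cmod (y j))" .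
  then have "l\<^sup>2 \<le> (\<Sum>j\<in>?I. cmod (x j) * cmod (y j))\<^sup>2"
    by (intro power_mono) (auto simp: l_def sum_nonneg)
  also have "\<dots> \<le> (\<Sum>j\<in>?I. (cmod (x j))\<^sup>2) * (\<Sum>j\<in>?I. (cmod (y j))\<^sup>2)"
    by (rule Cauchy_Schwarz_ineq_sum)
  also have "(\<Sum>j\<in>?I. (cmod (x j))\<^sup>2) = 1"
    using x by (simp add: unit_sphere_def vec_norm_eq)
  finally have ly: "l\<^sup>2 \<le> (\<Sum>j\<in>?I. (cmod (y j))\<^sup>2)" by simp

  have sgn_cnj: "sgn (cnj z) = cnj (sgn z)" for z :: complex by (simp add: sgn_eq)
  \<comment> \<open>\<open>q\<close> holds the coefficients of the tensor product of
    \<open>x\<close> with its conjugate. On \<open>S \<times> S\<close> none of them vanishes, so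
    the first-order estimate applies.\<close>
  define q where "q = (\<lambda>(s, t). c s * cnj (c t))"
  define b' where "b' = (\<lambda>(s, t). b s t)"
  have "q p \<noteq> 0" if "p \<in> S \<times> S" for p using that by (auto simp: q_def S_def)
  then obtain M where M: "\<And>\<delta>. (\<Sum>p\<in>S \<times> S. cmod (q p - of_real \<delta> * b' p))
    \<le> (\<Sum>p\<in>S \<times> S. cmod (q p)) - \<delta> * Re (\<Sum>p\<in>S \<times> S. b' p * cnj (sgn (q p))) + \<delta>\<^sup>2 * M"
    using sum_cmod_perturb_le[of "S \<times> S" q b'] by blast
  have q_sum: "(\<Sum>p\<in>S \<times> S. cmod (q p)) = l\<^sup>2"
    by (simp add: q_def lS power2_eq_square sum_product sum.cartesian_product norm_mult case_prod_unfold)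
  \<comment> \<open>The sign of \<open>c s * cnj (c t)\<close> factors, so for each \<open>j\<close>
    the double sum splits into \<open>y j\<close> times its conjugate.\<close>
  have "(\<Sum>p\<in>S \<times> S. b' p * cnj (sgn (q p)))
      = (\<Sum>s\<in>S. \<Sum>t\<in>S. \<Sum>j\<in>?I. (a j s * cnj (sgn (c s))) * cnj (a j t * cnj (sgn (c t))))"
    unfolding sum.cartesian_product[of _ S S]
    by (intro sum.cong)
      (auto simp: b'_def b_def q_def sgn_mult sgn_cnj sum_distrib_right sum_distrib_left mult_ac)
  also have "\<dots> = (\<Sum>s\<in>S. \<Sum>j\<in>?I. \<Sum>t\<in>S. (a j s * cnj (sgn (c s))) * cnj (a j t * cnj (sgn (c t))))"
    by (rule sum.cong[OF refl], rule sum.swap)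
  also have "\<dots> = (\<Sum>j\<in>?I. \<Sum>s\<in>S. \<Sum>t\<in>S. (a j s * cnj (sgn (c s))) * cnj (a j t * cnj (sgn (c t))))"
    by (rule sum.swap)
  also have "\<dots> = (\<Sum>j\<in>?I. y j * cnj (y j))"
    by (simp only: y_def cnj_sum sum_product)
  also have "\<dots> = of_real (\<Sum>j\<in>?I. (cmod (y j))\<^sup>2)"
    by (simp only: of_real_sum complex_norm_square)
  finally have Y: "Re (\<Sum>p\<in>S \<times> S. b' p * cnj (sgn (q p))) = (\<Sum>j\<in>?I. (cmod (y j))\<^sup>2)" by simp
  have "0 < (\<Sum>j\<in>?I. (cmod (y j))\<^sup>2) - R" using lR ly by simp
  then obtain \<delta> where \<delta>: "0 < \<delta>" "\<delta>\<^sup>2 * M < \<delta> * ((\<Sum>j\<in>?I. (cmod (y j))\<^sup>2) - R)"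
    by (rule small_quadratic_pos)

  \<comment> \<open>\<open>None\<close> stands for the entangled state and
    \<open>Some (s, t)\<close> for a product. The coefficient \<open>\<delta> * R\<close> restores
    what is removed from the products, because \<open>R\<close> times the entangled state is the sum
    of all \<open>e_j \<otimes> e_j\<close>.\<close>
  define \<beta> where "\<beta> = case_option (of_real (\<delta> * R)) (\<lambda>p. q p - of_real \<delta> * b' p)"
  define g where "g = case_option (max_entangled d n) (\<lambda>(s, t). tensor d n n s (conj_vec d n t))"
  define J where "J = insert None (Some ` (S \<times> S))"
  have sumJ: "sum f J = f None + (\<Sum>p\<in>S \<times> S. f (Some p))"
    for f :: "((nat list \<Rightarrow> complex) \<times> (nat list \<Rightarrow> complex)) option \<Rightarrow> 'z::comm_monoid_add"
    using SD(2) by (simp add: J_def sum.reindex image_iff)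
  have "extent d (2 * n) E (tensor d n n x (conj_vec d n x)) \<le> (\<Sum>j\<in>J. cmod (\<beta> j))\<^sup>2"
  proof (rule extent_le_family)
    show "finite J" using SD(2) by (simp add: J_def)
    show "finite E" by fact
    show "g ` J \<subseteq> E" using tens[OF subsetD[OF SD(1)] subsetD[OF SD(1)]] ent by (auto simp: J_def g_def)
    fix k assume k: "k \<in> nlists (2 * n) {..<d}"
    define u v where "u = take n k" and "v = drop n k"
    have uv: "u \<in> ?I" "v \<in> ?I" using take_drop_nlists[OF k] by (auto simp: u_def v_def)
    have xu: "(\<Sum>s\<in>S. c s * s u) = x u" and xv: "(\<Sum>s\<in>S. c s * s v) = x v"
      using cS uv by (auto simp: represents_def)
    have tk: "tensor d n n s (conj_vec d n t) k = s u * cnj (t v)" for s t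
      using uv by (simp add: tensor_apply[OF k] conj_vec_def u_def v_def)
    have "(\<Sum>p\<in>S \<times> S. q p * g (Some p) k) = (\<Sum>s\<in>S. c s * s u) * cnj (\<Sum>t\<in>S. c t * t v)"
      unfolding cnj_sum sum_product sum.cartesian_product
      by (intro sum.cong) (auto simp: q_def g_def tk mult_ac)
    then have Q: "(\<Sum>p\<in>S \<times> S. q p * g (Some p) k) = x u * cnj (x v)"
      by (simp only: xu xv)
    have "(\<Sum>p\<in>S \<times> S. b' p * g (Some p) k)
        = (\<Sum>s\<in>S. \<Sum>t\<in>S. \<Sum>j\<in>?I. (a j s * s u) * cnj (a j t * t v))"
      unfolding sum.cartesian_product[of _ S S]
      by (intro sum.cong) (auto simp: b'_def b_def g_def tk sum_distrib_right sum_distrib_left mult_ac)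
    also have "\<dots> = (\<Sum>s\<in>S. \<Sum>j\<in>?I. \<Sum>t\<in>S. (a j s * s u) * cnj (a j t * t v))"
      by (rule sum.cong[OF refl], rule sum.swap)
    also have "\<dots> = (\<Sum>j\<in>?I. \<Sum>s\<in>S. \<Sum>t\<in>S. (a j s * s u) * cnj (a j t * t v))"
      by (rule sum.swap)
    also have "\<dots> = (\<Sum>j\<in>?I. (\<Sum>s\<in>S. a j s * s u) * cnj (\<Sum>t\<in>S. a j t * t v))"
      by (simp only: cnj_sum sum_product)
    also have "\<dots> = (\<Sum>j\<in>?I. if j = u then (if u = v then 1 else 0) else 0)"
    proof (rule sum.cong[OF refl])
      fix j assume j: "j \<in> ?I"
      show "(\<Sum>s\<in>S. a j s * s u) * cnj (\<Sum>t\<in>S. a j t * t v)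
          = (if j = u then (if u = v then 1 else 0) else 0)"
        unfolding a_apply[OF j uv(1)] a_apply[OF j uv(2)] by auto
    qed
    also have "\<dots> = (if u = v then 1 else 0)" using uv by simp
    finally have B: "(\<Sum>p\<in>S \<times> S. b' p * g (Some p) k) = (if u = v then 1 else 0)" .
    have "(\<Sum>j\<in>J. \<beta> j * g j k) = of_real (\<delta> * R) * max_entangled d n k
        + (\<Sum>p\<in>S \<times> S. q p * g (Some p) k - of_real \<delta> * (b' p * g (Some p) k))"
      unfolding sumJ by (simp add: \<beta>_def g_def algebra_simps)
    also have "\<dots> = of_real (\<delta> * R) * max_entangled d n k + x u * cnj (x v)
        - of_real \<delta> * (if u = v then 1 else 0)"
      by (simp only: sum_subtractf sum_distrib_left[symmetric] Q B) simp
    also have "\<dots> = x u * cnj (x v)"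
      using R by (simp add: max_entangled_apply[OF k] u_def[symmetric] v_def[symmetric] R_def[symmetric])
    finally show "tensor d n n x (conj_vec d n x) k = (\<Sum>j\<in>J. \<beta> j * g j k)" by (simp add: tk)
  qed
  also have "(\<Sum>j\<in>J. cmod (\<beta> j)) = \<delta> * R + (\<Sum>p\<in>S \<times> S. cmod (q p - of_real \<delta> * b' p))"
    using \<delta>(1) R by (simp add: sumJ \<beta>_def norm_mult)
  also have "\<dots>\<^sup>2 < (l\<^sup>2)\<^sup>2"
  proof (rule power_strict_mono)
    show "\<delta> * R + (\<Sum>p\<in>S \<times> S. cmod (q p - of_real \<delta> * b' p)) < l\<^sup>2"
      using M[of \<delta>] \<delta>(2) unfolding q_sum Y by (simp add: algebra_simps)
    show "0 \<le> \<delta> * R + (\<Sum>p\<in>S \<times> S. cmod (q p - of_real \<delta> * b' p))"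
      using \<delta>(1) R by (simp add: sum_nonneg)
  qed simp
  finally show ?thesis by (simp add: ext l_def)
qed

subsection \<open>Measurability of the extent\<close>

text \<open>Stated for every function \<open>x\<close>, since continuity is shown on the whole
  function type. The extent sees only the coordinates in the index set, so \<open>x\<close> may be
  restricted to it.\<close>

lemma sqrt_extent_eq:
  assumes D: "dictionary d n D"
  obtains c where "represents d n D c x" "sqrt (extent d n D x) = (\<Sum>s\<in>D. cmod (c s))"
proof -
  let ?y = "restrict x (nlists n {..<d})"
  have rep: "represents d n D c ?y \<longleftrightarrow> represents d n D c x" for c
    by (simp add: represents_def)
  have "?y \<in> tensor_space d n" by (simp add: tensor_space_def)
  from extent_is_minimum[OF D this] obtain c where c: "represents d n D c ?y"
    "extent d n D ?y = (\<Sum>s\<in>D. cmod (c s))\<^sup>2" .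
  then have "extent d n D x = (\<Sum>s\<in>D. cmod (c s))\<^sup>2"
    by (simp add: extent_def rep)
  then have "sqrt (extent d n D x) = (\<Sum>s\<in>D. cmod (c s))"
    by (simp add: sum_nonneg)
  with c(1) show thesis using that rep by blast
qed

lemma extent_nonneg:
  assumes D: "dictionary d n D"
  shows "0 \<le> extent d n D x"
  by (metis sqrt_extent_eq[OF D] real_sqrt_ge_0_iff sum_nonneg norm_ge_zero)

text \<open>The square root of the extent is a seminorm. Fixed expansions of the basis vectors
  represent \<open>x - y\<close>, and \<open>K k\<close> is the l1 norm of the expansion of the
  \<open>k\<close>-th one.\<close>

lemma sqrt_extent_lipschitz:
  assumes D: "dictionary d n D"
  obtains K where "\<And>x y. sqrt (extent d n D x)
    \<le> sqrt (extent d n D y) + (\<Sum>k\<in>nlists n {..<d}. cmod (x k - y k) * K k)"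
proof -
  let ?I = "nlists n {..<d}"
  have "\<forall>j. \<exists>a. represents d n D a (basis_vec d n j)"
    using sqrt_extent_eq[OF D] by metis
  then obtain a where a: "\<And>j. represents d n D (a j) (basis_vec d n j)" by metis
  show thesis
  proof (rule that)
    fix x y :: "nat list \<Rightarrow> complex"
    obtain c where c: "represents d n D c y" "sqrt (extent d n D y) = (\<Sum>s\<in>D. cmod (c s))"
      by (rule sqrt_extent_eq[OF D])
    define b where "b s = c s + (\<Sum>j\<in>?I. (x j - y j) * a j s)" for s
    have "represents d n D b x"
      unfolding represents_def
    proof
      fix k assume k: "k \<in> ?I"
      have "(\<Sum>s\<in>D. (\<Sum>j\<in>?I. (x j - y j) * a j s) * s k)
          = (\<Sum>j\<in>?I. (x j - y j) * (\<Sum>s\<in>D. a j s * s k))"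
        unfolding sum_distrib_right sum_distrib_left by (subst sum.swap) (simp add: mult_ac)
      also have "\<dots> = (\<Sum>j\<in>?I. if j = k then x j - y j else 0)"
      proof (rule sum.cong[OF refl])
        fix j assume "j \<in> ?I"
        have "(\<Sum>s\<in>D. a j s * s k) = basis_vec d n j k"
          using a[of j] k by (simp add: represents_def)
        then show "(x j - y j) * (\<Sum>s\<in>D. a j s * s k) = (if j = k then x j - y j else 0)"
          using k by (auto simp: basis_vec_def)
      qed
      also have "\<dots> = x k - y k" using k by simp
      finally have 1: "(\<Sum>s\<in>D. (\<Sum>j\<in>?I. (x j - y j) * a j s) * s k) = x k - y k" .
      have 2: "(\<Sum>s\<in>D. c s * s k) = y k" using c(1) k by (simp add: represents_def)
      show "x k = (\<Sum>s\<in>D. b s * s k)"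
        by (simp only: b_def distrib_right sum.distrib 1 2) simp
    qed
    then have "extent d n D x \<le> (\<Sum>s\<in>D. cmod (b s))\<^sup>2" by (rule extent_le)
    then have "sqrt (extent d n D x) \<le> (\<Sum>s\<in>D. cmod (b s))"
      by (rule real_le_lsqrt[rotated]) (simp add: sum_nonneg)
    also have "\<dots> \<le> (\<Sum>s\<in>D. cmod (c s) + (\<Sum>j\<in>?I. cmod (x j - y j) * cmod (a j s)))"
      unfolding b_def
      by (intro sum_mono order.trans[OF norm_triangle_ineq] add_left_mono order.trans[OF norm_sum])
        (simp add: norm_mult)
    also have "\<dots> = sqrt (extent d n D y)
        + (\<Sum>j\<in>?I. cmod (x j - y j) * (\<Sum>s\<in>D. cmod (a j s)))"
      unfolding sum.distrib c(2) sum_distrib_left by (subst sum.swap) simp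
    finally show "sqrt (extent d n D x)
      \<le> sqrt (extent d n D y) + (\<Sum>k\<in>?I. cmod (x k - y k) * (\<Sum>s\<in>D. cmod (a k s)))" .
  qed
qed

lemma continuous_on_sqrt_extent:
  assumes D: "dictionary d n D"
  shows "continuous_on UNIV (\<lambda>x. sqrt (extent d n D x))"
  unfolding continuous_on_def
proof
  fix y :: "nat list \<Rightarrow> complex"
  let ?I = "nlists n {..<d}"
  obtain K where K: "\<And>x y. sqrt (extent d n D x)
    \<le> sqrt (extent d n D y) + (\<Sum>k\<in>?I. cmod (x k - y k) * K k)"
    using sqrt_extent_lipschitz[OF D] by blast
  define g where "g x = (\<Sum>k\<in>?I. cmod (x k - y k) * K k)" for x
  have "continuous_on UNIV g"
    unfolding g_def by (intro continuous_intros continuous_on_product_coordinates)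
  then have "(g \<longlongrightarrow> g y) (at y)"
    by (simp add: continuous_on_def)
  then have g: "(g \<longlongrightarrow> 0) (at y)"
    by (simp add: g_def)
  show "((\<lambda>x. sqrt (extent d n D x)) \<longlongrightarrow> sqrt (extent d n D y)) (at y)"
  proof (rule tendsto_sandwich)
    show "\<forall>\<^sub>F x in at y. sqrt (extent d n D y) - g x \<le> sqrt (extent d n D x)"
      using K[of y] by (auto simp: g_def norm_minus_commute algebra_simps)
    show "\<forall>\<^sub>F x in at y. sqrt (extent d n D x) \<le> sqrt (extent d n D y) + g x"
      using K[of _ y] by (auto simp: g_def)
    show "((\<lambda>x. sqrt (extent d n D y) - g x) \<longlongrightarrow> sqrt (extent d n D y)) (at y)"
      using tendsto_diff[OF tendsto_const g] by simp
    show "((\<lambda>x. sqrt (extent d n D y) + g x) \<longlongrightarrow> sqrt (extent d n D y)) (at y)"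
      using tendsto_add[OF tendsto_const g] by simp
  qed
qed

text \<open>Continuity gives measurability for the Borel sets of the full function type, which are
  the product sets over all lists. Padding by zeros carries the finite product into that space
  without changing the extent.\<close>

lemma measurable_extent:
  assumes D: "dictionary d n D"
  shows "extent d n D \<in> borel_measurable (\<Pi>\<^sub>M k\<in>nlists n {..<d}. borel)"
proof -
  let ?I = "nlists n {..<d}"
  let ?pad = "\<lambda>x k. if k \<in> ?I then x k else (0 :: complex)"
  have pad: "?pad \<in> (\<Pi>\<^sub>M k\<in>?I. borel) \<rightarrow>\<^sub>M (\<Pi>\<^sub>M k\<in>UNIV. borel)"
  proof (rule measurable_PiM_single')
    show "(\<lambda>x. ?pad x k) \<in> (\<Pi>\<^sub>M k\<in>?I. borel) \<rightarrow>\<^sub>M borel" for k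
      by (cases "k \<in> ?I") simp_all
  qed (auto simp: space_PiM)
  have "(\<lambda>x. sqrt (extent d n D x)) \<in> borel_measurable borel"
    by (rule borel_measurable_continuous_onI[OF continuous_on_sqrt_extent[OF D]])
  then have "(\<lambda>x. sqrt (extent d n D x)) \<in> borel_measurable (\<Pi>\<^sub>M k\<in>UNIV. borel)"
    by (simp add: measurable_cong_sets[OF sets_PiM_equal_borel refl])
  from measurable_compose[OF pad this]
  have "(\<lambda>x. (sqrt (extent d n D (?pad x)))\<^sup>2) \<in> borel_measurable (\<Pi>\<^sub>M k\<in>?I. borel)"
    by (rule borel_measurable_power)
  moreover have "(sqrt (extent d n D (?pad x)))\<^sup>2 = extent d n D x" for x
  proof -
    have "extent d n D (?pad x) = extent d n D x"
      by (simp add: extent_def represents_def)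
    moreover have "0 \<le> extent d n D x"
      by (rule extent_nonneg[OF D])
    ultimately show ?thesis by simp
  qed
  ultimately show ?thesis by simp
qed

subsection \<open>Haar-random vectors\<close>

text \<open>One of \<open>Re z\<close> and \<open>Im z\<close> carries at least half of
  \<open>(cmod z)^2\<close>, and a quarter turn makes it a nonnegative real part. This covers a
  condition on a modulus by four real caps.\<close>

lemma exists_quarter_turn_overlap:
  assumes "t * r\<^sup>2 \<le> (cmod z)\<^sup>2" "0 \<le> t" "0 \<le> r"
  shows "\<exists>\<omega>\<in>{1, -1, \<i>, -\<i>}. sqrt (t / 2) * r \<le> Re (cnj \<omega> * z)"
proof (rule ccontr)
  let ?e = "sqrt (t / 2) * r"
  assume "\<not> ?thesis"
  then have lt: "\<bar>Re z\<bar> < ?e" "\<bar>Im z\<bar> < ?e" by auto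
  have "\<bar>Re z\<bar>\<^sup>2 < ?e\<^sup>2" using lt(1) by (rule power_strict_mono) simp_all
  moreover have "\<bar>Im z\<bar>\<^sup>2 < ?e\<^sup>2" using lt(2) by (rule power_strict_mono) simp_all
  moreover have "?e\<^sup>2 = t * r\<^sup>2 / 2"
    using assms by (simp add: power_mult_distrib)
  ultimately show False
    using assms(1) by (simp add: cmod_power2)
qed

text \<open>With \<open>r\<close> the norm of \<open>x\<close>, expanding the square around the
  centre \<open>sqrt (t / 2) * \<omega> * s\<close> and using the cap condition gives at most
  \<open>r^2 - t * r + t / 2\<close>. This falls short of \<open>1 - t / 2\<close> by
  \<open>(1 - r) * (r + 1 - t)\<close>, which is nonnegative.\<close>

lemma cap_subset_small_ball:
  assumes x: "x \<in> tensor_space d n" "vec_norm d n x \<le> 1"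
    and s: "vec_norm d n s = 1" and \<omega>: "cmod \<omega> = 1"
    and t: "0 \<le> t" "t \<le> 1"
    and cap: "sqrt (t / 2) * vec_norm d n x \<le> Re (cnj \<omega> * cinner d n s x)"
  shows "(\<Sum>k\<in>nlists n {..<d}. (cmod (x k - of_real (sqrt (t / 2)) * \<omega> * s k))\<^sup>2) \<le> 1 - t / 2"
proof -
  let ?I = "nlists n {..<d}"
  let ?e = "sqrt (t / 2)"
  define r where "r = vec_norm d n x"
  have r: "0 \<le> r" "r \<le> 1" "r\<^sup>2 = (\<Sum>k\<in>?I. (cmod (x k))\<^sup>2)"
    using x by (auto simp: r_def vec_norm_eq sum_nonneg)
  have s1: "(\<Sum>k\<in>?I. (cmod (s k))\<^sup>2) = 1" using s by (simp add: vec_norm_eq)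
  have e2: "?e\<^sup>2 = t / 2" using t by simp
  have "(cmod (x k - of_real ?e * \<omega> * s k))\<^sup>2
      = (cmod (x k))\<^sup>2 - 2 * ?e * Re (cnj \<omega> * (cnj (s k) * x k)) + ?e\<^sup>2 * (cmod (s k))\<^sup>2" for k
  proof -
    have "(cmod (u - v))\<^sup>2 = (cmod u)\<^sup>2 - 2 * Re (cnj v * u) + (cmod v)\<^sup>2" for u v
      unfolding cmod_power2 by (simp add: power2_eq_square algebra_simps)
    from this[of "x k" "of_real ?e * (\<omega> * s k)"] show ?thesis
      by (simp only: mult.assoc complex_cnj_mult complex_cnj_complex_of_real Re_complex_of_real
        norm_mult power_mult_distrib norm_of_real power2_abs \<omega> times_complex.sel Im_complex_of_real)
        simp
  qed
  then have "(\<Sum>k\<in>?I. (cmod (x k - of_real ?e * \<omega> * s k))\<^sup>2)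
      = r\<^sup>2 - 2 * ?e * Re (cnj \<omega> * cinner d n s x) + ?e\<^sup>2"
    by (simp only: sum.distrib sum_subtractf sum_distrib_left[symmetric] Re_sum[symmetric] s1
      r(3)[symmetric] cinner_def[symmetric])
  also have "\<dots> \<le> r\<^sup>2 - 2 * ?e * (?e * r) + ?e\<^sup>2"
    using cap t by (intro add_right_mono diff_left_mono mult_left_mono) (auto simp: r_def)
  also have "\<dots> = r\<^sup>2 - t * r + t / 2"
    using e2 by (simp add: power2_eq_square)
  also have "\<dots> \<le> 1 - t / 2"
  proof -
    have "0 \<le> (1 - r) * (r + 1 - t)" using r t by (intro mult_nonneg_nonneg) auto
    then show ?thesis by (simp add: algebra_simps power2_eq_square)
  qed
  finally show ?thesis .
qed

lemma space_PiM_tensor_space: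
  assumes "\<And>k. space (M k) = UNIV"
  shows "space (PiM (nlists n {..<d}) M) = tensor_space d n"
  using assms by (simp add: space_PiM tensor_space_def)

lemma cinner_normalize_vec:
  "cinner d n s (normalize_vec d n x) = cinner d n s x / of_real (vec_norm d n x)"
  by (simp add: cinner_def normalize_vec_def sum_divide_distrib)

text \<open>The probability is a ratio of volumes in the unit ball. Four balls of radius
  \<open>sqrt (1 - t / 2)\<close>, one for each quarter turn, cover the cone over the event, and the
  real dimension is \<open>2 * d ^ n\<close>.\<close>

lemma haar_sphere_overlap_tail:
  assumes s: "cinner d n s s = 1" and t: "0 < t" "t \<le> 1"
  shows "emeasure (haar_sphere d n) {x \<in> tensor_space d n. t \<le> (cmod (cinner d n s x))\<^sup>2}
    \<le> ennreal (4 * (1 - t / 2) ^ (d ^ n))"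
proof -
  let ?I = "nlists n {..<d}"
  let ?M = "\<Pi>\<^sub>M k\<in>?I. (lborel :: complex measure)"
  let ?A = "{x \<in> tensor_space d n. t \<le> (cmod (cinner d n s x))\<^sup>2}"
  let ?T = "normalize_vec d n"
  define B where "B = {x \<in> tensor_space d n. vec_norm d n x \<le> 1}"
  define C where "C \<omega> = {x \<in> ?I \<rightarrow>\<^sub>E UNIV.
    (\<Sum>k\<in>?I. (cmod (x k - of_real (sqrt (t / 2)) * \<omega> * s k))\<^sup>2) \<le> (sqrt (1 - t / 2))\<^sup>2}" for \<omega>
  have sp: "space ?M = tensor_space d n" "space (\<Pi>\<^sub>M k\<in>?I. (borel :: complex measure)) = tensor_space d n"
    by (simp_all add: space_PiM_tensor_space)
  have B: "B \<in> sets ?M" unfolding B_def sp[symmetric] by measurable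
  have B_eq: "B = {x \<in> ?I \<rightarrow>\<^sub>E UNIV. (\<Sum>k\<in>?I. (cmod (x k))\<^sup>2) \<le> 1}"
    by (simp add: B_def tensor_space_def vec_norm_eq)
  have C: "C \<omega> \<in> sets ?M" for \<omega>
    unfolding C_def tensor_space_def[symmetric] sp[symmetric] by measurable
  have emC: "emeasure ?M (C \<omega>) = ennreal ((1 - t / 2) ^ (d ^ n)) * emeasure ?M B" for \<omega>
    unfolding C_def B_eq using t
    by (subst emeasure_PiM_lborel_ball) (simp_all add: power_mult card_nlists_lessThan)
  have A: "?A \<in> sets (\<Pi>\<^sub>M k\<in>?I. borel)"
    unfolding sp(2)[symmetric] cinner_def by measurable
  have T: "?T \<in> uniform_measure ?M B \<rightarrow>\<^sub>M (\<Pi>\<^sub>M k\<in>?I. borel)"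
    using measurable_normalize_vec by simp
  have TA: "?T -` ?A \<inter> space ?M \<in> sets ?M"
    using measurable_sets[OF measurable_normalize_vec A] .
  have "B \<inter> (?T -` ?A \<inter> space ?M) \<subseteq> (\<Union>\<omega>\<in>{1, -1, \<i>, -\<i>}. C \<omega>)"
  proof
    fix x assume "x \<in> B \<inter> (?T -` ?A \<inter> space ?M)"
    then have x: "x \<in> tensor_space d n" "vec_norm d n x \<le> 1"
      and *: "t \<le> (cmod (cinner d n s x / of_real (vec_norm d n x)))\<^sup>2"
      by (auto simp: B_def cinner_normalize_vec)
    have "0 \<le> vec_norm d n x" by (simp add: vec_norm_eq sum_nonneg)
    \<comment> \<open>At the origin division by zero gives overlap 0, which is below
      \<open>t\<close>.\<close>
    moreover have "vec_norm d n x \<noteq> 0" using * t by auto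
    ultimately have pos: "0 < vec_norm d n x" by simp
    have "t * (vec_norm d n x)\<^sup>2 \<le> (cmod (cinner d n s x))\<^sup>2"
      using * pos by (simp add: norm_divide power_divide field_simps)
    from exists_quarter_turn_overlap[OF this less_imp_le[OF t(1)] less_imp_le[OF pos]]
    obtain \<omega> where \<omega>: "\<omega> \<in> {1, -1, \<i>, -\<i>}"
      "sqrt (t / 2) * vec_norm d n x \<le> Re (cnj \<omega> * cinner d n s x)" by blast
    have "vec_norm d n s = 1" using s by (simp add: vec_norm_def)
    from cap_subset_small_ball[OF x this _ _ t(2) \<omega>(2)] \<omega>(1) t(1)
    have "(\<Sum>k\<in>?I. (cmod (x k - of_real (sqrt (t / 2)) * \<omega> * s k))\<^sup>2) \<le> 1 - t / 2"
      by auto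
    then have "x \<in> C \<omega>" using x t by (simp add: C_def tensor_space_def)
    then show "x \<in> (\<Union>\<omega>\<in>{1, -1, \<i>, -\<i>}. C \<omega>)" using \<omega>(1) by blast
  qed
  then have "emeasure ?M (B \<inter> (?T -` ?A \<inter> space ?M)) \<le> emeasure ?M (\<Union>\<omega>\<in>{1, -1, \<i>, -\<i>}. C \<omega>)"
    using C by (intro emeasure_mono) auto
  also have "\<dots> \<le> (\<Sum>\<omega>\<in>{1, -1, \<i>, -\<i>}. emeasure ?M (C \<omega>))"
    using C by (intro emeasure_subadditive_finite) auto
  also have "\<dots> = of_nat (card {1, -1, \<i>, -\<i>}) * (ennreal ((1 - t / 2) ^ (d ^ n)) * emeasure ?M B)"
    unfolding emC by simp
  also have "\<dots> \<le> 4 * (ennreal ((1 - t / 2) ^ (d ^ n)) * emeasure ?M B)"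
    by (intro mult_right_mono) (auto simp: card_insert_if)
  also have "\<dots> = ennreal (4 * (1 - t / 2) ^ (d ^ n)) * emeasure ?M B"
    using t by (simp add: ennreal_mult mult.assoc)
  finally have le: "emeasure ?M (B \<inter> (?T -` ?A \<inter> space ?M))
    \<le> ennreal (4 * (1 - t / 2) ^ (d ^ n)) * emeasure ?M B" .
  have "emeasure (haar_sphere d n) ?A = emeasure ?M (B \<inter> (?T -` ?A \<inter> space ?M)) / emeasure ?M B"
    unfolding haar_sphere_def B_def[symmetric]
    using A B TA T by (simp add: emeasure_distr)
  also have "\<dots> \<le> ennreal (4 * (1 - t / 2) ^ (d ^ n)) * emeasure ?M B / emeasure ?M B"
    using le by (rule divide_right_mono_ennreal)
  also have "\<dots> \<le> ennreal (4 * (1 - t / 2) ^ (d ^ n))"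
  \<comment> \<open>In the degenerate cases the quotient is 0 by the conventions of
    \<open>ennreal\<close>.\<close>
  proof (cases "emeasure ?M B = 0 \<or> emeasure ?M B = \<infinity>")
    case True
    then show ?thesis by (auto simp: divide_ennreal_def)
  next
    case False
    then show ?thesis by (simp add: ennreal_mult_divide_eq)
  qed
  finally show ?thesis .
qed

text \<open>A hyperplane through the origin is invariant under normalization, so its Lebesgue
  nullity passes to the sphere.\<close>

lemma AE_haar_sphere_not_orthogonal:
  assumes j: "j \<in> nlists n {..<d}" "w j \<noteq> 0"
  shows "AE x in haar_sphere d n. (\<Sum>k\<in>nlists n {..<d}. w k * x k) \<noteq> 0"
proof -
  let ?I = "nlists n {..<d}"
  let ?M = "\<Pi>\<^sub>M k\<in>?I. (lborel :: complex measure)"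
  let ?B = "{x \<in> tensor_space d n. vec_norm d n x \<le> 1}"
  have sp: "space ?M = tensor_space d n" by (simp add: space_PiM_tensor_space)
  have B: "?B \<in> sets ?M" unfolding sp[symmetric] by measurable
  have "AE x in ?M. x \<notin> {x \<in> ?I \<rightarrow>\<^sub>E UNIV. (\<Sum>k\<in>?I. w k * x k) = 0}"
    by (rule AE_not_in[OF null_sets_hyperplane[of ?I j w, OF finite_nlists_lessThan j]])
  with AE_space[of ?M] have "AE x in ?M. (\<Sum>k\<in>?I. w k * normalize_vec d n x k) \<noteq> 0"
  proof eventually_elim
    case (elim x)
    then have ne: "(\<Sum>k\<in>?I. w k * x k) \<noteq> 0" by (auto simp: space_PiM)
    have "vec_norm d n x \<noteq> 0"
    proof
      assume "vec_norm d n x = 0"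
      then have "\<forall>k\<in>?I. x k = 0" by (simp add: vec_norm_eq sum_nonneg_eq_0_iff)
      then show False using ne by simp
    qed
    moreover have "(\<Sum>k\<in>?I. w k * normalize_vec d n x k)
        = (\<Sum>k\<in>?I. w k * x k) / of_real (vec_norm d n x)"
      by (simp add: normalize_vec_def sum_divide_distrib)
    ultimately show ?case using ne by simp
  qed
  then have "AE x in uniform_measure ?M ?B. (\<Sum>k\<in>?I. w k * normalize_vec d n x k) \<noteq> 0"
    using B by (intro AE_uniform_measureI) auto
  moreover have "{x \<in> space (\<Pi>\<^sub>M k\<in>?I. borel). (\<Sum>k\<in>?I. w k * x k) \<noteq> 0} \<in> sets (\<Pi>\<^sub>M k\<in>?I. borel)"
    by measurable
  ultimately show ?thesis
    unfolding haar_sphere_def using measurable_normalize_vec[of d n]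
    by (subst AE_distr_iff) auto
qed

text \<open>A subset \<open>S\<close> that does not span lies in a fixed hyperplane, which almost
  surely misses \<open>x\<close>. A finite \<open>D\<close> has only finitely many subsets.\<close>

lemma AE_haar_sphere_support_spans:
  assumes D: "finite D"
  shows "AE x in haar_sphere d n. \<forall>S\<in>Pow D. (\<exists>c. represents d n S c x)
    \<longrightarrow> (\<forall>j\<in>nlists n {..<d}. \<exists>a. represents d n S a (basis_vec d n j))"
proof (rule AE_finite_allI)
  let ?I = "nlists n {..<d}"
  fix S assume "S \<in> Pow D"
  then have S: "finite S" using D by (auto intro: finite_subset)
  show "AE x in haar_sphere d n. (\<exists>c. represents d n S c x)
    \<longrightarrow> (\<forall>j\<in>?I. \<exists>a. represents d n S a (basis_vec d n j))"
  proof (cases "\<forall>j\<in>?I. \<exists>a. represents d n S a (basis_vec d n j)")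
    case False
    then obtain j where j: "j \<in> ?I" "\<nexists>a. represents d n S a (basis_vec d n j)" by blast
    then have "\<nexists>a. \<forall>k\<in>?I. basis_vec d n j k = (\<Sum>s\<in>S. a s * s k)"
      by (simp add: represents_def)
    then obtain w where w: "\<forall>s\<in>S. (\<Sum>k\<in>?I. w k * s k) = 0"
      "(\<Sum>k\<in>?I. w k * basis_vec d n j k) \<noteq> 0"
      using span_or_separating_functional[OF S finite_nlists_lessThan[of n d],
        where v = "\<lambda>s. s" and x = "basis_vec d n j"]
      by blast
    have "(\<Sum>k\<in>?I. w k * basis_vec d n j k) = (\<Sum>k\<in>?I. if k = j then w k else 0)"
      by (intro sum.cong) (auto simp: basis_vec_def)
    then have "w j \<noteq> 0" using w(2) j(1) by simp
    from AE_haar_sphere_not_orthogonal[of j n d w, OF j(1) this] show ?thesis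
    proof eventually_elim
      case (elim x)
      have "\<not> represents d n S c x" for c
      proof
        assume c: "represents d n S c x"
        have "(\<Sum>k\<in>?I. w k * x k) = (\<Sum>k\<in>?I. \<Sum>s\<in>S. c s * (w k * s k))"
          using c by (intro sum.cong) (auto simp: represents_def sum_distrib_left mult_ac)
        also have "\<dots> = (\<Sum>s\<in>S. c s * (\<Sum>k\<in>?I. w k * s k))"
          by (subst sum.swap) (simp add: sum_distrib_left)
        also have "\<dots> = 0" using w(1) by simp
        finally show False using elim by simp
      qed
      then show ?case by blast
    qed
  qed simp
qed (use D in simp)

text \<open>Almost surely \<open>x\<close> lies in the good event or overlaps too much with some
  \<open>s\<close> in \<open>D\<close>; a union bound over \<open>D\<close> controls the
  latter.\<close>

lemma prob_submultiplicative_ge: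
  assumes d: "0 < d" and D: "dictionary d n D" and E: "dictionary d (2 * n) E"
    and norm: "\<And>s. s \<in> D \<Longrightarrow> cinner d n s s = 1"
    and conj: "\<And>s. s \<in> D \<Longrightarrow> conj_vec d n s \<in> D"
    and tens: "\<And>s t. s \<in> D \<Longrightarrow> t \<in> D \<Longrightarrow> tensor d n n s t \<in> E"
    and ent: "max_entangled d n \<in> E"
  shows "measure (haar_sphere d n) {\<psi> \<in> unit_sphere d n.
      extent d (2 * n) E (tensor d n n \<psi> (conj_vec d n \<psi>))
        < extent d n D \<psi> * extent d n D (conj_vec d n \<psi>)}
    \<ge> 1 - 4 * real (card D) * exp (- sqrt (real d ^ n) / 4)"
    (is "measure ?P ?G \<ge> _")
proof -
  let ?I = "nlists n {..<d}"
  let ?N = "\<Pi>\<^sub>M k\<in>?I. (borel :: complex measure)"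
  \<comment> \<open>The threshold of \<open>small\<close> in the deterministic lemma; it makes
    \<open>d ^ n * (t / 2)\<close> equal to \<open>sqrt (d ^ n) / 4\<close>, the exponent of the
    bound.\<close>
  define t where "t = 1 / (2 * sqrt (real d ^ n))"
  define Bad where "Bad s = {x \<in> tensor_space d n. t \<le> (cmod (cinner d n s x))\<^sup>2}" for s
  interpret P: prob_space ?P by (rule prob_space_haar_sphere[OF d])
  have finD: "finite D" using D by (simp add: dictionary_def)
  have N1: "1 \<le> real d ^ n" using d by (intro one_le_power) simp
  then have "1 \<le> 2 * sqrt (real d ^ n)" by (intro order.trans[OF _ mult_mono[of 1 2 1]]) simp_all
  moreover from this have "0 < 2 * sqrt (real d ^ n)" by linarith
  ultimately have t: "0 < t" "t \<le> 1"
    unfolding t_def by (simp_all only: divide_le_eq_1_pos zero_less_divide_1_iff)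
  have sp: "space ?N = tensor_space d n" by (simp add: space_PiM_tensor_space)
  have sets: "sets ?P = sets ?N" "space ?P = space ?N" by (simp_all add: haar_sphere_def)
  have G: "?G \<in> P.events"
  proof -
    have [measurable]: "cnj \<in> borel_measurable borel"
      by (intro borel_measurable_continuous_onI continuous_intros)
    have conj_m: "conj_vec d n \<in> ?N \<rightarrow>\<^sub>M ?N"
      unfolding conj_vec_def[abs_def] by (intro measurable_restrict) measurable
    have tensor_m: "(\<lambda>x. tensor d n n x (conj_vec d n x)) \<in> ?N \<rightarrow>\<^sub>M (\<Pi>\<^sub>M k\<in>nlists (2 * n) {..<d}. borel)"
      unfolding tensor_def mult_2[symmetric]
    proof (rule measurable_restrict)
      fix k assume k: "k \<in> nlists (2 * n) {..<d}"
      have eq: "conj_vec d n x (drop n k) = cnj (x (drop n k))" for x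
        using take_drop_nlists[OF k] by (simp add: conj_vec_def)
      have [measurable]: "(\<lambda>x. x (take n k)) \<in> borel_measurable ?N"
        "(\<lambda>x. x (drop n k)) \<in> borel_measurable ?N"
        using take_drop_nlists[OF k] by (auto intro!: measurable_component_singleton)
      show "(\<lambda>x. x (take n k) * conj_vec d n x (drop n k)) \<in> borel_measurable ?N"
        unfolding eq by measurable
    qed
    note [measurable] = measurable_extent[OF D] measurable_compose[OF conj_m measurable_extent[OF D]]
      measurable_compose[OF tensor_m measurable_extent[OF E]]
    have "{x \<in> space ?N. extent d (2 * n) E (tensor d n n x (conj_vec d n x))
        < extent d n D x * extent d n D (conj_vec d n x)} \<in> sets ?N"
      by measurable
    then have "unit_sphere d n \<inter> {x \<in> space ?N. extent d (2 * n) E (tensor d n n x (conj_vec d n x))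
        < extent d n D x * extent d n D (conj_vec d n x)} \<in> P.events"
      using sets_unit_sphere[of d n] sets(1) by blast
    also have "unit_sphere d n \<inter> {x \<in> space ?N. extent d (2 * n) E (tensor d n n x (conj_vec d n x))
        < extent d n D x * extent d n D (conj_vec d n x)} = ?G"
      by (auto simp: sp unit_sphere_def)
    finally show ?thesis .
  qed
  have Bad: "Bad s \<in> P.events" for s
    unfolding Bad_def sets sp[symmetric] cinner_def by measurable
  have "AE x in ?P. x \<in> ?G \<union> (\<Union>s\<in>D. Bad s)"
    using AE_haar_sphere_unit[OF d, of n] AE_haar_sphere_support_spans[OF finD, of d n]
  proof eventually_elim
    case (elim x)
    have xt: "x \<in> tensor_space d n" using elim by (simp add: unit_sphere_def)
    show ?case
    proof (cases "\<exists>s\<in>D. x \<in> Bad s")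
      case False
      have "extent d (2 * n) E (tensor d n n x (conj_vec d n x)) < (extent d n D x)\<^sup>2"
      proof (rule extent_tensor_conj_less[OF _ D])
        show "finite E" using E by (simp add: dictionary_def)
        show "tensor d n n s (conj_vec d n t) \<in> E" if "s \<in> D" "t \<in> D" for s t
          using that by (intro tens conj)
        show "(cmod (cinner d n s x))\<^sup>2 \<le> 1 / (2 * sqrt (real d ^ n))" if "s \<in> D" for s
          using False that xt by (auto simp: Bad_def t_def not_le intro: less_imp_le)
        show "\<exists>a. represents d n S a (basis_vec d n j)"
          if "S \<subseteq> D" "represents d n S c x" "j \<in> ?I" for S c j
          using elim that by blast
      qed (use d ent elim in auto)
      also have "(extent d n D x)\<^sup>2 \<le> extent d n D x * extent d n D (conj_vec d n x)"
        unfolding power2_eq_square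
        by (intro mult_left_mono extent_le_extent_conj[OF D conj] extent_nonneg[OF D])
      finally show ?thesis using elim by simp
    qed blast
  qed
  then have "P.prob (?G \<union> (\<Union>s\<in>D. Bad s)) = 1"
    using G Bad finD by (subst P.prob_eq_1) auto
  moreover have "P.prob (?G \<union> (\<Union>s\<in>D. Bad s)) \<le> P.prob ?G + P.prob (\<Union>s\<in>D. Bad s)"
    using G Bad finD by (intro measure_Un_le) auto
  ultimately have "1 - P.prob ?G \<le> P.prob (\<Union>s\<in>D. Bad s)" by linarith
  also have "\<dots> \<le> (\<Sum>s\<in>D. P.prob (Bad s))"
    using Bad finD by (intro measure_UNION_le) auto
  also have "\<dots> \<le> (\<Sum>s\<in>D. 4 * exp (- sqrt (real d ^ n) / 4))"
  proof (rule sum_mono)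
    fix s assume s: "s \<in> D"
    have "P.prob (Bad s) \<le> 4 * (1 - t / 2) ^ (d ^ n)"
      using haar_sphere_overlap_tail[OF norm[OF s] t] t
      unfolding Bad_def P.emeasure_eq_measure by (simp add: ennreal_le_iff)
    also have "(1 - t / 2) ^ (d ^ n) \<le> exp (- (t / 2)) ^ (d ^ n)"
      using t exp_ge_add_one_self[of "- (t / 2)"] by (intro power_mono) auto
    also have "exp (- (t / 2)) ^ (d ^ n) = exp (- sqrt (real d ^ n) / 4)"
    proof -
      have "real (d ^ n) * (t / 2) = sqrt (real d ^ n) / 4"
        using N1 real_div_sqrt[of "real d ^ n"] by (simp add: t_def field_simps)
      then show ?thesis by (simp add: exp_of_nat_mult[symmetric])
    qed
    finally show "P.prob (Bad s) \<le> 4 * exp (- sqrt (real d ^ n) / 4)" by simp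
  qed
  finally show ?thesis by simp
qed

text \<open>Eventually \<open>m n\<close> is at most \<open>exp (sqrt (d ^ n) / 8)\<close>, which
  uses up half of the exponential decay.\<close>

lemma card_times_exp_tendsto_0:
  fixes d :: nat and m :: "nat \<Rightarrow> nat"
  assumes d: "2 \<le> d"
    and small: "(\<lambda>n. log (real d) (real (m n))) \<in> o(\<lambda>n. sqrt (real d ^ n))"
  shows "(\<lambda>n. 4 * real (m n) * exp (- sqrt (real d ^ n) / 4)) \<longlonglongrightarrow> 0"
proof (rule tendsto_sandwich[where f = "\<lambda>_. 0"])
  have lnd: "0 < ln (real d)" using d by simp
  \<comment> \<open>The factor \<open>1 / ln d\<close> passes from base \<open>d\<close> to the
    natural logarithm; 8 is twice the 4 in the exponent.\<close>
  then have "\<forall>\<^sub>F n in sequentially. norm (log (real d) (real (m n)))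
      \<le> 1 / (8 * ln (real d)) * norm (sqrt (real d ^ n))"
    by (intro landau_o.smallD[OF small]) simp
  then show "\<forall>\<^sub>F n in sequentially. 4 * real (m n) * exp (- sqrt (real d ^ n) / 4)
      \<le> 4 * exp (- (sqrt (real d ^ n) / 8))"
  proof eventually_elim
    case (elim n)
    let ?r = "sqrt (real d ^ n)"
    have "real (m n) \<le> exp (?r / 8)"
    \<comment> \<open>The value 0 is treated apart, as \<open>exp (ln m) = m\<close> requires
      \<open>m > 0\<close>.\<close>
    proof (cases "m n = 0")
      case False
      have "ln (real (m n)) / ln (real d) \<le> 1 / (8 * ln (real d)) * ?r"
        using order.trans[OF abs_ge_self elim[unfolded real_norm_def]] by (simp add: log_def)
      then have "ln (real (m n)) \<le> ?r / 8" using lnd by (simp add: field_simps)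
      then show ?thesis using False by (metis exp_le_cancel_iff exp_ln neq0_conv of_nat_0_less_iff)
    qed simp
    then have "real (m n) * exp (- ?r / 4) \<le> exp (?r / 8) * exp (- ?r / 4)"
      by (intro mult_right_mono) auto
    also have "\<dots> = exp (- (?r / 8))" by (simp add: exp_add[symmetric])
    finally show ?case by simp
  qed
  have "filterlim (\<lambda>n. real d ^ n) at_top sequentially"
    using d by (intro filterlim_at_infinity_imp_filterlim_at_top
      filterlim_realpow_sequentially_gt1 always_eventually) auto
  then have "filterlim (\<lambda>n. sqrt (real d ^ n)) at_top sequentially"
    by (rule filterlim_compose[OF sqrt_at_top])
  then have "filterlim (\<lambda>n. sqrt (real d ^ n) / 8) at_top sequentially"
    using filterlim_tendsto_pos_mult_at_top[OF tendsto_const[of "1 / 8 :: real"]] by simp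
  then have "filterlim (\<lambda>n. - (sqrt (real d ^ n) / 8)) at_bot sequentially"
    by (simp add: filterlim_uminus_at_bot)
  then have "(\<lambda>n. exp (- (sqrt (real d ^ n) / 8))) \<longlonglongrightarrow> 0"
    by (rule filterlim_compose[OF exp_at_bot])
  then show "(\<lambda>n. 4 * exp (- (sqrt (real d ^ n) / 8))) \<longlonglongrightarrow> 0"
    using tendsto_mult_left[of _ 0 _ "4::real"] by fastforce
  show "\<forall>\<^sub>F n in sequentially. 0 \<le> 4 * real (m n) * exp (- sqrt (real d ^ n) / 4)"
    by simp
qed (rule tendsto_const)

theorem theorem1:
  fixes d :: nat and D :: "nat \<Rightarrow> (nat list \<Rightarrow> complex) set"
  assumes "2 \<le> d"
    and "\<And>n. 1 \<le> n \<Longrightarrow> dictionary d n (D n)"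
    and "\<And>n s. 1 \<le> n \<Longrightarrow> s \<in> D n \<Longrightarrow> cinner d n s s = 1"
    and "(\<lambda>n. log (real d) (real (card (D n)))) \<in> o(\<lambda>n. sqrt (real d ^ n))"
    and "\<And>n s. 1 \<le> n \<Longrightarrow> s \<in> D n \<Longrightarrow> conj_vec d n s \<in> D n"
    and "\<And>n\<^sub>1 n\<^sub>2. 1 \<le> n\<^sub>1 \<Longrightarrow> 1 \<le> n\<^sub>2 \<Longrightarrow>
           {tensor d n\<^sub>1 n\<^sub>2 s\<^sub>1 s\<^sub>2 | s\<^sub>1 s\<^sub>2. s\<^sub>1 \<in> D n\<^sub>1 \<and> s\<^sub>2 \<in> D n\<^sub>2} \<subseteq> D (n\<^sub>1 + n\<^sub>2)"
    and "\<And>n. 1 \<le> n \<Longrightarrow> max_entangled d n \<in> D (2 * n)"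
  shows "(\<exists>\<epsilon> \<in> o(\<lambda>_. 1 :: real). \<forall>n\<ge>1.
            measure (haar_sphere d n)
              {\<psi> \<in> unit_sphere d n.
                 extent d (2 * n) (D (2 * n)) (tensor d n n \<psi> (conj_vec d n \<psi>))
                   < extent d n (D n) \<psi> * extent d n (D n) (conj_vec d n \<psi>)}
              \<ge> 1 - \<epsilon> n)
       \<and> (\<forall>\<^sub>F n in sequentially. \<exists>\<psi> \<in> unit_sphere d n.
            extent d (2 * n) (D (2 * n)) (tensor d n n \<psi> (conj_vec d n \<psi>))
              < extent d n (D n) \<psi> * extent d n (D n) (conj_vec d n \<psi>))"
proof -
  let ?G = "\<lambda>n. {\<psi> \<in> unit_sphere d n.
     extent d (2 * n) (D (2 * n)) (tensor d n n \<psi> (conj_vec d n \<psi>))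
       < extent d n (D n) \<psi> * extent d n (D n) (conj_vec d n \<psi>)}"
  define \<epsilon> where "\<epsilon> n = 4 * real (card (D n)) * exp (- sqrt (real d ^ n) / 4)" for n
  have lim: "\<epsilon> \<longlonglongrightarrow> 0"
    unfolding \<epsilon>_def[abs_def] by (rule card_times_exp_tendsto_0[OF assms(1,4)])
  then have small: "\<epsilon> \<in> o(\<lambda>_. 1)" by (intro smalloI_tendsto) simp_all
  have prob: "1 - \<epsilon> n \<le> measure (haar_sphere d n) (?G n)" if n: "1 \<le> n" for n
    unfolding \<epsilon>_def
  proof (rule prob_submultiplicative_ge)
    show "tensor d n n s t \<in> D (2 * n)" if "s \<in> D n" "t \<in> D n" for s t
      using assms(6)[OF n n] that by (auto simp: mult_2)
  qed (use n assms in auto)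
  have "\<forall>\<^sub>F n in sequentially. \<epsilon> n < 1" by (rule order_tendstoD(2)[OF lim]) simp
  then have "\<forall>\<^sub>F n in sequentially. \<exists>\<psi> \<in> unit_sphere d n.
      extent d (2 * n) (D (2 * n)) (tensor d n n \<psi> (conj_vec d n \<psi>))
        < extent d n (D n) \<psi> * extent d n (D n) (conj_vec d n \<psi>)"
    using eventually_ge_at_top[of 1]
  proof eventually_elim
    case (elim n)
    \<comment> \<open>Once \<open>\<epsilon> n < 1\<close> the good event has positive probability
      and therefore contains a vector.\<close>
    then have "0 < measure (haar_sphere d n) (?G n)" using prob[of n] by simp
    then have "?G n \<noteq> {}" by (metis less_irrefl measure_empty)
    then show ?case by blast
  qed
  with small prob show ?thesis by blast
qed

end
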